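(* Let $\Bbbk$ be a field of characteristic zero, let $V$ be a special Gel'fand--Dorfman algebra over $\Bbbk$, and let $L(V)$ be the quadratic Lie conformal algebra related to $V$. Let $(\mathcal U(L(V);3),\tau_U)$ be the universal associative enveloping conformal algebra of $L(V)$ relative to the constant associative locality bound $N=3$ on the set of generators $V$ of the $\Bbbk[\partial]$-module $L(V)$. Then $L(V)$ embeds into $\mathcal U(L(V);3)$, i.e., the canonical homomorphism of Lie conformal algebras $\tau_U: L(V)\to \mathcal U(L(V);3)^{(-)}$ is injective.
   Context: $\Bbbk$ is a field of characteristic $0$ and $H=\Bbbk[\partial]$. **Gel'fand--Dorfman algebras.** A Novikov algebra is a vector space $V$ with a bilinear operation $\circ$ such that $(a\circ b)\circ c-a\circ(b\circ c)=(b\circ a)\circ c-b\circ(a\circ c)$ and $(a\circ b)\circ c=(a\circ c)\circ b$ for all $a,b,c\in V$. A Gel'fand--Dorfman (GD) algebra is a vector space $V$ with bilinear operations $\circ$ and $[\cdot,\cdot]$ such that $(V,\circ)$ is a Novikov algebra, $(V,[\cdot,\cdot])$ is a Lie algebra, and $[a,b\circ c]-[c,b\circ a]-b\circ[a,c]+[b,a]\circ c-[b,c]\circ a=0$ for all $a,b,c\in V$. A Poisson algebra $P$ is an associative commutative algebra with a Lie bracket $\{\cdot,\cdot\}$ satisfying $\{a,b\cdot c\}=b\cdot\{a,c\}+\{a,b\}\cdot c$. If $d$ is a derivation of the Poisson algebra $P$ (a derivation of both operations), then $a\circ b=a\cdot d(b)$, $[a,b]=\{a,b\}$ define a GD algebra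 structure on $P$, denoted $P^{(d)}$. A GD algebra $V$ is special if there is a Poisson algebra $P$ with a derivation $d$ and an injective homomorphism of GD algebras $V\hookrightarrow P^{(d)}$. **Lie conformal algebras.** A Lie conformal algebra is an $H$-module $C$ with a linear map $[\cdot{}_{(\lambda)}\cdot]:C\otimes C\to C[\lambda]$ such that for all $a,b,c\in C$: $[\partial a{}_{(\lambda)}b]=-\lambda[a{}_{(\lambda)}b]$, $[a{}_{(\lambda)}\partial b]=(\partial+\lambda)[a{}_{(\lambda)}b]$; $[a{}_{(\lambda)}b]=-[b{}_{(-\partial-\lambda)}a]$; $[[a{}_{(\lambda)}b]{}_{(\lambda+\mu)}c]=[a{}_{(\lambda)}[b{}_{(\mu)}c]]-[b{}_{(\mu)}[a{}_{(\lambda)}c]]$. For a GD algebra $V$, the quadratic Lie conformal algebra $L(V)$ is the free $H$-module $H\otimes V$ with the bracket determined by $[a{}_{(\lambda)}b]=[a,b]+\partial(b\circ a)+\lambda(a\circ b+b\circ a)$ for $a,b\in V$. **Associative conformal algebras.** An associative conformal algebra is an $H$-module $A$ with a linear map $(\cdot{}_{(\lambda)}\cdot):A\otimes A\to A[\lambda]$ such that $(\partial a{}_{(\lambda)}b)=-\lambda(a{}_{(\lambda)}b)$, $(a{}_{(\lambda)}\partial b)=(\partial+\lambda)(a{}_{(\lambda)}b)$, and $((a{}_{(\lambda)}b){}_{(\lambda+\mu)}c)=(a{}_{(\lambda)}(b{}_{(\mu)}c))$. For $a,b\in A$ the locality is $N(a,b)=\deg_\lambda(a{}_{(\lambda)}b)+1$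 if $(a{}_{(\lambda)}b)\neq0$, and $N(a,b)=0$ otherwise. $A^{(-)}$ denotes the Lie conformal algebra on the $H$-module $A$ with bracket $[a{}_{(\lambda)}b]=(a{}_{(\lambda)}b)-(b{}_{(-\partial-\lambda)}a)$. **Universal envelopes.** An associative enveloping conformal algebra of a Lie conformal algebra $C$ is a pair $(A,\tau)$, where $A$ is an associative conformal algebra and $\tau:C\to A^{(-)}$ is a homomorphism of Lie conformal algebras such that $A$ is generated, as an associative conformal algebra, by $\tau(C)$. Let $C$ be generated as an $H$-module by a subset $B$, and let $N:B\times B\to\mathbb Z_+$ be a function. The universal associative enveloping conformal algebra $(\mathcal U(C;N),\tau_U)$ relative to $N$ is an associative enveloping conformal algebra of $C$ with $N(\tau_U(a),\tau_U(b))\le N(a,b)$ for all $a,b\in B$, such that for every associative enveloping conformal algebra $(A,\tau)$ of $C$ with $N(\tau(a),\tau(b))\le N(a,b)$ for all $a,b\in B$ there is a homomorphism of associative conformal algebras $\varphi:\mathcal U(C;N)\to A$ with $\tau=\varphi\circ\tau_U$. It is known that it always exists (but $\tau_U$ need not be injective). Here $C=L(V)$, $B=V$ and $N\equiv3$. *)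

theory Defs
  imports "HOL-Computational_Algebra.Polynomial" "HOL-Library.Function_Algebras"
begin

section \<open>Gel'fand--Dorfman algebras\<close>

locale bilinear_algebra = vector_space scale
  for scale :: "'k::field \<Rightarrow> 'v::ab_group_add \<Rightarrow> 'v" +
  fixes mul :: "'v \<Rightarrow> 'v \<Rightarrow> 'v"
  assumes linear_left: "Vector_Spaces.linear scale scale (\<lambda>x. mul x y)"
    and linear_right: "Vector_Spaces.linear scale scale (mul x)"

locale novikov_algebra = bilinear_algebra scale circ
  for scale :: "'k::field \<Rightarrow> 'v::ab_group_add \<Rightarrow> 'v"
    and circ :: "'v \<Rightarrow> 'v \<Rightarrow> 'v" (infixl "\<odot>" 70) +
  assumes left_symmetric: "(a \<odot> b) \<odot> c - a \<odot> (b \<odot> c) = (b \<odot> a) \<odot> c - b \<odot> (a \<odot> c)"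
    and right_commutative: "(a \<odot> b) \<odot> c = (a \<odot> c) \<odot> b"

locale lie_algebra = bilinear_algebra scale br
  for scale :: "'k::field \<Rightarrow> 'v::ab_group_add \<Rightarrow> 'v"
    and br :: "'v \<Rightarrow> 'v \<Rightarrow> 'v" +
  assumes alternating: "br a a = 0"
    and jacobi: "br a (br b c) + br b (br c a) + br c (br a b) = 0"

locale gelfand_dorfman_algebra =
  novikov_algebra scale circ + lie_algebra scale br
  for scale :: "'k::field \<Rightarrow> 'v::ab_group_add \<Rightarrow> 'v"
    and circ :: "'v \<Rightarrow> 'v \<Rightarrow> 'v" (infixl "\<odot>" 70)
    and br :: "'v \<Rightarrow> 'v \<Rightarrow> 'v" +
  assumes compatible:
    "br a (b \<odot> c) - br c (b \<odot> a) - b \<odot> br a c + br b a \<odot> c - br b c \<odot> a = 0"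

text \<open>Poisson algebras are not required to be unital.\<close>

locale poisson_algebra =
  bilinear_algebra scale mul + lie_algebra scale br
  for scale :: "'k::field \<Rightarrow> 'p::ab_group_add \<Rightarrow> 'p"
    and mul :: "'p \<Rightarrow> 'p \<Rightarrow> 'p" (infixl "\<cdot>" 70)
    and br :: "'p \<Rightarrow> 'p \<Rightarrow> 'p" +
  assumes mul_assoc: "(a \<cdot> b) \<cdot> c = a \<cdot> (b \<cdot> c)"
    and mul_commute: "a \<cdot> b = b \<cdot> a"
    and leibniz: "br a (b \<cdot> c) = b \<cdot> br a c + br a b \<cdot> c"

locale differential_poisson_algebra = poisson_algebra scale mul br
  for scale :: "'k::field \<Rightarrow> 'p::ab_group_add \<Rightarrow> 'p"
    and mul :: "'p \<Rightarrow> 'p \<Rightarrow> 'p" (infixl "\<cdot>" 70)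
    and br :: "'p \<Rightarrow> 'p \<Rightarrow> 'p" +
  fixes d :: "'p \<Rightarrow> 'p"
  assumes derivation_linear: "Vector_Spaces.linear scale scale d"
    and derivation_mul: "d (a \<cdot> b) = d a \<cdot> b + a \<cdot> d b"
    and derivation_br: "d (br a b) = br (d a) b + br a (d b)"

definition gd_hom ::
  "('k::field \<Rightarrow> 'v::ab_group_add \<Rightarrow> 'v) \<Rightarrow> ('v \<Rightarrow> 'v \<Rightarrow> 'v) \<Rightarrow> ('v \<Rightarrow> 'v \<Rightarrow> 'v) \<Rightarrow>
   ('k \<Rightarrow> 'w::ab_group_add \<Rightarrow> 'w) \<Rightarrow> ('w \<Rightarrow> 'w \<Rightarrow> 'w) \<Rightarrow> ('w \<Rightarrow> 'w \<Rightarrow> 'w) \<Rightarrow>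
   ('v \<Rightarrow> 'w) \<Rightarrow> bool" where
  "gd_hom scale1 circ1 br1 scale2 circ2 br2 f \<longleftrightarrow>
     Vector_Spaces.linear scale1 scale2 f \<and>
     (\<forall>a b. f (circ1 a b) = circ2 (f a) (f b)) \<and>
     (\<forall>a b. f (br1 a b) = br2 (f a) (f b))"

text \<open>
  HOL has no quantifier over types, so the type \<open>'p\<close> of the ambient Poisson algebra is a
  parameter.  As a premise with \<open>'p\<close> not occurring in the conclusion, this is
  the existence of a suitable Poisson algebra on some type.
\<close>

definition special_gd_algebra ::
  "'p::ab_group_add itself \<Rightarrow> ('k::field \<Rightarrow> 'v::ab_group_add \<Rightarrow> 'v) \<Rightarrow>
   ('v \<Rightarrow> 'v \<Rightarrow> 'v) \<Rightarrow> ('v \<Rightarrow> 'v \<Rightarrow> 'v) \<Rightarrow> bool" where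
  "special_gd_algebra (_ :: 'p itself) scale circ br \<longleftrightarrow>
     gelfand_dorfman_algebra scale circ br \<and>
     (\<exists>(scaleP :: 'k \<Rightarrow> 'p \<Rightarrow> 'p) mulP brP d f.
        differential_poisson_algebra scaleP mulP brP d \<and>
        gd_hom scale circ br scaleP (\<lambda>a b. mulP a (d b)) brP f \<and> inj f)"


section \<open>Conformal algebras\<close>

text \<open>
  \<open>C[\<lambda>]\<close> is the type \<open>'c poly\<close>, with multiplication by \<open>\<lambda>\<close> being \<open>pCons 0\<close>.
  \<open>C[\<lambda>,\<mu>]\<close> is \<open>'c poly poly\<close> with \<open>\<lambda>\<close> the inner and \<open>\<mu>\<close> the outer variable.
  For \<open>p = \<Sum> \<lambda>\<^sup>i c\<^sub>i\<close>, the term \<open>subst_op X e p\<close> is \<open>\<Sum> X\<^sup>i (e c\<^sub>i)\<close>, that is, the operator \<open>X\<close>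
  is substituted for the variable, and \<open>e\<close> is applied to the coefficients.
\<close>

definition subst_op :: "('b \<Rightarrow> 'b) \<Rightarrow> ('a::zero \<Rightarrow> 'b::comm_monoid_add) \<Rightarrow> 'a poly \<Rightarrow> 'b" where
  "subst_op X e p = (\<Sum>i\<le>degree p. (X ^^ i) (e (coeff p i)))"

definition lam_op :: "'c::ab_group_add poly poly \<Rightarrow> 'c poly poly" where
  "lam_op = map_poly (pCons 0)"

definition mu_op :: "'c::ab_group_add poly poly \<Rightarrow> 'c poly poly" where
  "mu_op = pCons 0"

definition lam_mu_op :: "'c::ab_group_add poly poly \<Rightarrow> 'c poly poly" where
  "lam_mu_op P = lam_op P + mu_op P"

text \<open>
  For a \<open>\<lambda>\<close>-product \<open>pr\<close>, \<open>left_nested pr X Z a b c\<close> is \<open>((a \<^sub>X b) \<^sub>Z c)\<close> and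
  \<open>right_nested pr X Y a b c\<close> is \<open>(a \<^sub>X (b \<^sub>Y c))\<close>, where \<open>X\<close>, \<open>Y\<close>, \<open>Z\<close> are operators on
  \<open>C[\<lambda>,\<mu>]\<close>.
\<close>

definition left_nested ::
  "('c::ab_group_add \<Rightarrow> 'c \<Rightarrow> 'c poly) \<Rightarrow> ('c poly poly \<Rightarrow> 'c poly poly) \<Rightarrow>
   ('c poly poly \<Rightarrow> 'c poly poly) \<Rightarrow> 'c \<Rightarrow> 'c \<Rightarrow> 'c \<Rightarrow> 'c poly poly" where
  "left_nested pr X Z a b c = subst_op X (\<lambda>u. subst_op Z (\<lambda>v. [:[:v:]:]) (pr u c)) (pr a b)"

definition right_nested ::
  "('c::ab_group_add \<Rightarrow> 'c \<Rightarrow> 'c poly) \<Rightarrow> ('c poly poly \<Rightarrow> 'c poly poly) \<Rightarrow>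
   ('c poly poly \<Rightarrow> 'c poly poly) \<Rightarrow> 'c \<Rightarrow> 'c \<Rightarrow> 'c \<Rightarrow> 'c poly poly" where
  "right_nested pr X Y a b c = subst_op Y (\<lambda>u. subst_op X (\<lambda>v. [:[:v:]:]) (pr a u)) (pr b c)"

text \<open>\<open>opposite D pr a b\<close> is \<open>(b \<^sub>-\<^sub>\<partial>\<^sub>-\<^sub>\<lambda> a)\<close>, where \<open>D\<close> is the action of \<open>\<partial>\<close>.\<close>

definition opposite ::
  "('c::ab_group_add \<Rightarrow> 'c) \<Rightarrow> ('c \<Rightarrow> 'c \<Rightarrow> 'c poly) \<Rightarrow> 'c \<Rightarrow> 'c \<Rightarrow> 'c poly" where
  "opposite D pr a b = subst_op (\<lambda>q. - map_poly D q - pCons 0 q) (\<lambda>v. [:v:]) (pr b a)"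

text \<open>
  \<open>H = 'k poly\<close>.  The underlying \<open>H\<close>-module of a conformal algebra is a submodule \<open>C\<close>, possibly
  proper, of an \<open>H\<close>-module on the whole type; the values of \<open>pr\<close> outside \<open>C\<close> are irrelevant.
\<close>

locale conformal_product = module hs
  for hs :: "'k::field poly \<Rightarrow> 'c::ab_group_add \<Rightarrow> 'c" +
  fixes C :: "'c set" and pr :: "'c \<Rightarrow> 'c \<Rightarrow> 'c poly"
  assumes subspace_C: "subspace C"
    and closed: "\<lbrakk>a \<in> C; b \<in> C\<rbrakk> \<Longrightarrow> coeff (pr a b) n \<in> C"
    and add_left: "\<lbrakk>a \<in> C; a' \<in> C; b \<in> C\<rbrakk> \<Longrightarrow> pr (a + a') b = pr a b + pr a' b"
    and add_right: "\<lbrakk>a \<in> C; b \<in> C; b' \<in> C\<rbrakk> \<Longrightarrow> pr a (b + b') = pr a b + pr a b'"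
    and scale_left: "\<lbrakk>a \<in> C; b \<in> C\<rbrakk> \<Longrightarrow> pr (hs [:k:] a) b = map_poly (hs [:k:]) (pr a b)"
    and scale_right: "\<lbrakk>a \<in> C; b \<in> C\<rbrakk> \<Longrightarrow> pr a (hs [:k:] b) = map_poly (hs [:k:]) (pr a b)"
    and sesqui_left: "\<lbrakk>a \<in> C; b \<in> C\<rbrakk> \<Longrightarrow> pr (hs [:0, 1:] a) b = - pCons 0 (pr a b)"
    and sesqui_right: "\<lbrakk>a \<in> C; b \<in> C\<rbrakk> \<Longrightarrow>
      pr a (hs [:0, 1:] b) = map_poly (hs [:0, 1:]) (pr a b) + pCons 0 (pr a b)"

locale lie_conformal_algebra = conformal_product hs C lb
  for hs :: "'k::field poly \<Rightarrow> 'c::ab_group_add \<Rightarrow> 'c"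
    and C :: "'c set" and lb :: "'c \<Rightarrow> 'c \<Rightarrow> 'c poly" +
  assumes conformal_skew:
      "\<lbrakk>a \<in> C; b \<in> C\<rbrakk> \<Longrightarrow> lb a b = - opposite (hs [:0, 1:]) lb a b"
    and conformal_jacobi:
      "\<lbrakk>a \<in> C; b \<in> C; c \<in> C\<rbrakk> \<Longrightarrow>
       left_nested lb lam_op lam_mu_op a b c =
       right_nested lb lam_op mu_op a b c - right_nested lb mu_op lam_op b a c"

locale assoc_conformal_algebra = conformal_product hs A pr
  for hs :: "'k::field poly \<Rightarrow> 'a::ab_group_add \<Rightarrow> 'a"
    and A :: "'a set" and pr :: "'a \<Rightarrow> 'a \<Rightarrow> 'a poly" +
  assumes conformal_assoc:
      "\<lbrakk>a \<in> A; b \<in> A; c \<in> A\<rbrakk> \<Longrightarrow>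
       left_nested pr lam_op lam_mu_op a b c = right_nested pr lam_op mu_op a b c"

definition conformal_hom ::
  "('k::field poly \<Rightarrow> 'c::ab_group_add \<Rightarrow> 'c) \<Rightarrow> 'c set \<Rightarrow> ('c \<Rightarrow> 'c \<Rightarrow> 'c poly) \<Rightarrow>
   ('k poly \<Rightarrow> 'a::ab_group_add \<Rightarrow> 'a) \<Rightarrow> 'a set \<Rightarrow> ('a \<Rightarrow> 'a \<Rightarrow> 'a poly) \<Rightarrow>
   ('c \<Rightarrow> 'a) \<Rightarrow> bool" where
  "conformal_hom hsC C prC hsA A prA f \<longleftrightarrow>
     f ` C \<subseteq> A \<and>
     (\<forall>x\<in>C. \<forall>y\<in>C. f (x + y) = f x + f y) \<and>
     (\<forall>h. \<forall>x\<in>C. f (hsC h x) = hsA h (f x)) \<and>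
     (\<forall>x\<in>C. \<forall>y\<in>C. prA (f x) (f y) = map_poly f (prC x y))"

definition commutator_product ::
  "('k::field poly \<Rightarrow> 'a::ab_group_add \<Rightarrow> 'a) \<Rightarrow> ('a \<Rightarrow> 'a \<Rightarrow> 'a poly) \<Rightarrow> 'a \<Rightarrow> 'a \<Rightarrow> 'a poly" where
  "commutator_product hs pr a b = pr a b - opposite (hs [:0, 1:]) pr a b"

definition locality :: "('a::zero \<Rightarrow> 'a \<Rightarrow> 'a poly) \<Rightarrow> 'a \<Rightarrow> 'a \<Rightarrow> nat" where
  "locality pr a b = (if pr a b = 0 then 0 else degree (pr a b) + 1)"

definition conformal_subalgebra ::
  "('k::field poly \<Rightarrow> 'a::ab_group_add \<Rightarrow> 'a) \<Rightarrow> ('a \<Rightarrow> 'a \<Rightarrow> 'a poly) \<Rightarrow> 'a set \<Rightarrow> bool" where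
  "conformal_subalgebra hs pr S \<longleftrightarrow>
     module.subspace hs S \<and> (\<forall>a\<in>S. \<forall>b\<in>S. \<forall>n. coeff (pr a b) n \<in> S)"


section \<open>Quadratic Lie conformal algebras\<close>

text \<open>
  \<open>H \<otimes> V\<close> is the type \<open>'v poly\<close> of polynomials in \<open>\<partial>\<close> with coefficients in \<open>V\<close>.
\<close>

definition free_scale :: "('k::field \<Rightarrow> 'v::ab_group_add \<Rightarrow> 'v) \<Rightarrow> 'k poly \<Rightarrow> 'v poly \<Rightarrow> 'v poly" where
  "free_scale scale h f = subst_op (pCons 0) (\<lambda>k. map_poly (scale k) f) h"

text \<open>
  On generators, the bracket \<open>[a \<^sub>\<lambda> b] = [a,b] + \<partial>(b \<circ> a) + \<lambda>(a \<circ> b + b \<circ> a)\<close> is an element of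
  \<open>'v poly poly\<close> with inner variable \<open>\<partial>\<close> and outer variable \<open>\<lambda>\<close>.  It is extended by
  \<open>[f(\<partial>)a \<^sub>\<lambda> g(\<partial>)b] = f(-\<lambda>) g(\<partial> + \<lambda>) [a \<^sub>\<lambda> b]\<close>.
\<close>

definition quadratic_generator_bracket ::
  "('v::ab_group_add \<Rightarrow> 'v \<Rightarrow> 'v) \<Rightarrow> ('v \<Rightarrow> 'v \<Rightarrow> 'v) \<Rightarrow> 'v \<Rightarrow> 'v \<Rightarrow> 'v poly poly" where
  "quadratic_generator_bracket circ br a b =
     [: [: br a b, circ b a :], [: circ a b + circ b a :] :]"

definition quadratic_bracket ::
  "('v::ab_group_add \<Rightarrow> 'v \<Rightarrow> 'v) \<Rightarrow> ('v \<Rightarrow> 'v \<Rightarrow> 'v) \<Rightarrow> 'v poly \<Rightarrow> 'v poly \<Rightarrow> 'v poly poly" where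
  "quadratic_bracket circ br f g =
     subst_op (\<lambda>Q. - pCons 0 Q)
       (\<lambda>a. subst_op (\<lambda>Q. map_poly (pCons 0) Q + pCons 0 Q)
          (\<lambda>b. quadratic_generator_bracket circ br a b) g) f"


section \<open>Universal associative enveloping conformal algebras\<close>

definition assoc_envelope ::
  "('k::field poly \<Rightarrow> 'c::ab_group_add \<Rightarrow> 'c) \<Rightarrow> 'c set \<Rightarrow> ('c \<Rightarrow> 'c \<Rightarrow> 'c poly) \<Rightarrow>
   ('k poly \<Rightarrow> 'a::ab_group_add \<Rightarrow> 'a) \<Rightarrow> 'a set \<Rightarrow> ('a \<Rightarrow> 'a \<Rightarrow> 'a poly) \<Rightarrow>
   ('c \<Rightarrow> 'a) \<Rightarrow> bool" where
  "assoc_envelope hsC C lb hsA A pr \<tau> \<longleftrightarrow>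
     lie_conformal_algebra hsC C lb \<and>
     assoc_conformal_algebra hsA A pr \<and>
     conformal_hom hsC C lb hsA A (commutator_product hsA pr) \<tau> \<and>
     (\<forall>S. S \<subseteq> A \<and> conformal_subalgebra hsA pr S \<and> \<tau> ` C \<subseteq> S \<longrightarrow> S = A)"

text \<open>
  The universal property quantifies over all envelopes, which HOL can only do within one
  type.  An envelope is spanned over \<open>\<bbbk>\<close> by the values of the monomials below, so, as a vector space,
  it embeds into the space \<open>'c conf_monomial \<Rightarrow> 'k\<close>, and its \<open>H\<close>-module structure
  extends to that space.  Hence every envelope is isomorphic to one whose underlying
  module is a submodule \<open>A\<close> of some \<open>H\<close>-module on this type, and the universal property
  extends to envelopes on arbitrary types: see theorem \<open>universal_envelope_property\<close>.
\<close>

datatype 'c conf_monomial =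
  Gen 'c
| Der "'c conf_monomial"
| NProd nat "'c conf_monomial" "'c conf_monomial"

definition universal_assoc_envelope ::
  "('k::field poly \<Rightarrow> 'c::ab_group_add \<Rightarrow> 'c) \<Rightarrow> 'c set \<Rightarrow> ('c \<Rightarrow> 'c \<Rightarrow> 'c poly) \<Rightarrow>
   'c set \<Rightarrow> ('c \<Rightarrow> 'c \<Rightarrow> nat) \<Rightarrow>
   ('k poly \<Rightarrow> 'u::ab_group_add \<Rightarrow> 'u) \<Rightarrow> 'u set \<Rightarrow> ('u \<Rightarrow> 'u \<Rightarrow> 'u poly) \<Rightarrow>
   ('c \<Rightarrow> 'u) \<Rightarrow> bool" where
  "universal_assoc_envelope hsC C lb B N hsU U prU \<tau>U \<longleftrightarrow>
     B \<subseteq> C \<and> module.span hsC B = C \<and>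
     assoc_envelope hsC C lb hsU U prU \<tau>U \<and>
     (\<forall>a\<in>B. \<forall>b\<in>B. locality prU (\<tau>U a) (\<tau>U b) \<le> N a b) \<and>
     (\<forall>(hsA :: 'k poly \<Rightarrow> ('c conf_monomial \<Rightarrow> 'k) \<Rightarrow> ('c conf_monomial \<Rightarrow> 'k)) A prA \<tau>.
        assoc_envelope hsC C lb hsA A prA \<tau> \<and>
        (\<forall>a\<in>B. \<forall>b\<in>B. locality prA (\<tau> a) (\<tau> b) \<le> N a b) \<longrightarrow>
        (\<exists>\<phi>. conformal_hom hsU U prU hsA A prA \<phi> \<and> (\<forall>c\<in>C. \<tau> c = \<phi> (\<tau>U c))))"


section \<open>The universal property on arbitrary types\<close>


lemma additive_funpow: "additive (X :: 'b::ab_group_add \<Rightarrow> 'b) \<Longrightarrow> additive (X ^^ n)"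
  by (induction n) (auto simp: additive_def)

lemma subst_op_eq_sum:
  fixes X :: "'b::ab_group_add \<Rightarrow> 'b"
  assumes X: "additive X" and e: "e 0 = 0" and n: "degree p \<le> n"
  shows "subst_op X e p = (\<Sum>i\<le>n. (X ^^ i) (e (coeff p i)))"
  unfolding subst_op_def
proof (rule sum.mono_neutral_left)
  show "\<forall>i\<in>{..n} - {..degree p}. (X ^^ i) (e (coeff p i)) = 0"
  proof
    fix i assume "i \<in> {..n} - {..degree p}"
    then have "coeff p i = 0" by (simp add: coeff_eq_0)
    then show "(X ^^ i) (e (coeff p i)) = 0"
      using e additive.zero[OF additive_funpow[OF X]] by simp
  qed
qed (use n in auto)

lemma subst_op_transfer:
  fixes X :: "'b::ab_group_add \<Rightarrow> 'b" and Y :: "'d::ab_group_add \<Rightarrow> 'd"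
  assumes F: "additive F" and Y: "additive Y"
    and XY: "\<And>u. Q u \<Longrightarrow> Q (X u) \<and> F (X u) = Y (F u)"
    and Q: "\<And>i. Q (e (coeff p i))"
    and eq: "\<And>i. F (e (coeff p i)) = e' (f (coeff p i))"
    and zero: "f 0 = 0" "e' 0 = 0"
  shows "F (subst_op X e p) = subst_op Y e' (map_poly f p)"
proof -
  have pow: "Q ((X ^^ i) u) \<and> F ((X ^^ i) u) = (Y ^^ i) (F u)" if "Q u" for i u
    using that by (induction i) (auto dest: XY)
  have "F (subst_op X e p) = (\<Sum>i\<le>degree p. F ((X ^^ i) (e (coeff p i))))"
    unfolding subst_op_def by (rule additive.sum[OF F])
  also have "\<dots> = (\<Sum>i\<le>degree p. (Y ^^ i) (e' (coeff (map_poly f p) i)))"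
    using pow[OF Q] by (simp add: eq coeff_map_poly zero)
  also have "\<dots> = subst_op Y e' (map_poly f p)"
    by (rule subst_op_eq_sum[symmetric]) (auto simp: Y zero map_poly_degree_leq)
  finally show ?thesis .
qed

lemma additive_map_poly: "additive f \<Longrightarrow> additive (map_poly f)"
  by (rule additive.intro, intro poly_eqI)
     (simp add: coeff_map_poly additive.zero additive.add)

lemma additive_lam_op: "additive lam_op"
  unfolding lam_op_def by (rule additive_map_poly) (simp add: additive_def)

lemma additive_mu_op: "additive mu_op"
  by (simp add: additive_def mu_op_def)

lemma additive_lam_mu_op: "additive lam_mu_op"
  by (rule additive.intro)
    (simp add: lam_mu_op_def additive.add[OF additive_lam_op] additive.add[OF additive_mu_op])

lemma map_lam_op:
  assumes "additive g"
  shows "map_poly (map_poly g) (lam_op P) = lam_op (map_poly (map_poly g) P)"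
  unfolding lam_op_def
  by (intro poly_eqI) (simp add: coeff_map_poly map_poly_pCons additive.zero[OF assms])

lemma map_mu_op:
  "map_poly (map_poly g) (mu_op P) = mu_op (map_poly (map_poly g) P)"
  unfolding mu_op_def by (simp add: map_poly_pCons)

lemma map_lam_mu_op:
  assumes "additive g"
  shows "map_poly (map_poly g) (lam_mu_op P) = lam_mu_op (map_poly (map_poly g) P)"
  unfolding lam_mu_op_def
  by (simp add: additive.add[OF additive_map_poly[OF additive_map_poly[OF assms]]]
      map_lam_op[OF assms] map_mu_op)

lemma (in conformal_product) zero_left: "b \<in> C \<Longrightarrow> pr 0 b = 0"
  using add_left[of 0 0 b] subspace_0[OF subspace_C] by simp

lemma (in conformal_product) zero_right: "a \<in> C \<Longrightarrow> pr a 0 = 0"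
  using add_right[of a 0 0] subspace_0[OF subspace_C] by simp

lemma conformal_subalgebraD:
  assumes "conformal_subalgebra hs pr S"
  shows "module.subspace hs S" "a \<in> S \<Longrightarrow> b \<in> S \<Longrightarrow> coeff (pr a b) n \<in> S"
  using assms unfolding conformal_subalgebra_def by auto

lemma conformal_homD:
  assumes "conformal_hom hsC C prC hsA A prA f"
  shows "x \<in> C \<Longrightarrow> f x \<in> A"
    "x \<in> C \<Longrightarrow> y \<in> C \<Longrightarrow> f (x + y) = f x + f y"
    "x \<in> C \<Longrightarrow> f (hsC h x) = hsA h (f x)"
    "x \<in> C \<Longrightarrow> y \<in> C \<Longrightarrow> prA (f x) (f y) = map_poly f (prC x y)"
  using assms unfolding conformal_hom_def by auto

lemma transport_envelope:
  fixes hsA :: "'k::field poly \<Rightarrow> 'a::ab_group_add \<Rightarrow> 'a"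
    and hsT :: "'k poly \<Rightarrow> 't::ab_group_add \<Rightarrow> 't"
  assumes env: "assoc_envelope hsC C lb hsA A prA \<tau>"
    and g: "additive g" and r: "additive r"
    and rA: "\<And>t. r t \<in> A" and rg: "\<And>x. x \<in> A \<Longrightarrow> r (g x) = x"
    and modT: "module hsT" and hsT: "\<And>p x. x \<in> A \<Longrightarrow> hsT p (g x) = g (hsA p x)"
  defines "prT \<equiv> \<lambda>s t. map_poly g (prA (r s) (r t))"
  shows "assoc_envelope hsC C lb hsT (g ` A) prT (g \<circ> \<tau>)"
proof -
  interpret A: assoc_conformal_algebra hsA A prA using env by (simp add: assoc_envelope_def)
  interpret C: lie_conformal_algebra hsC C lb using env by (simp add: assoc_envelope_def)
  interpret T: module hsT by (rule modT)
  have hom: "conformal_hom hsC C lb hsA A (commutator_product hsA prA) \<tau>"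
    and gen: "\<And>S. S \<subseteq> A \<Longrightarrow> conformal_subalgebra hsA prA S \<Longrightarrow> \<tau> ` C \<subseteq> S \<Longrightarrow> S = A"
    using env by (auto simp: assoc_envelope_def)
  have hsA: "x \<in> A \<Longrightarrow> hsA p x \<in> A" for x p
    using A.subspace_C by (simp add: A.subspace_scale)
  have addA: "x \<in> A \<Longrightarrow> y \<in> A \<Longrightarrow> x + y \<in> A" for x y
    using A.subspace_C by (simp add: A.subspace_add)
  have g0: "g 0 = 0" by (rule additive.zero[OF g])
  have prT: "prT (g x) (g y) = map_poly g (prA x y)" if "x \<in> A" "y \<in> A" for x y
    using that by (simp add: prT_def rg)
  have cmp: "conformal_product hsT (g ` A) prT"
  proof
    show "T.subspace (g ` A)"
    proof (rule T.subspaceI)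
      show "0 \<in> g ` A"
        using A.subspace_0[OF A.subspace_C] by (intro image_eqI[where x = 0]) (simp_all add: g0)
    qed (auto simp: additive.add[OF g, symmetric] hsT intro!: imageI addA hsA)
  next
    fix a b n assume "a \<in> g ` A" "b \<in> g ` A"
    then show "coeff (prT a b) n \<in> g ` A"
      by (auto simp: prT coeff_map_poly g0 intro!: imageI A.closed)
  next
    fix a a' b assume "a \<in> g ` A" "a' \<in> g ` A" "b \<in> g ` A"
    then show "prT (a + a') b = prT a b + prT a' b"
      by (auto simp: prT addA additive.add[OF g, symmetric] additive.add[OF additive_map_poly[OF g], symmetric] A.add_left)
  next
    fix a b b' assume "a \<in> g ` A" "b \<in> g ` A" "b' \<in> g ` A"
    then show "prT a (b + b') = prT a b + prT a b'"
      by (auto simp: prT addA additive.add[OF g, symmetric] additive.add[OF additive_map_poly[OF g], symmetric] A.add_right)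
  next
    fix a b k assume "a \<in> g ` A" "b \<in> g ` A"
    then obtain x y where xy: "a = g x" "b = g y" "x \<in> A" "y \<in> A" by auto
    have m: "map_poly g (map_poly (hsA h) (prA x y)) = map_poly (hsT h) (map_poly g (prA x y))" for h
      by (intro poly_eqI) (simp add: coeff_map_poly g0 hsT A.closed xy)
    have pc: "map_poly g (pCons 0 P) = pCons 0 (map_poly g P)" for P
      by (simp add: map_poly_pCons g0)
    note mp = additive_map_poly[OF g]
    show "prT (hsT [:k:] a) b = map_poly (hsT [:k:]) (prT a b)"
      by (simp add: xy hsT prT hsA A.scale_left m)
    show "prT a (hsT [:k:] b) = map_poly (hsT [:k:]) (prT a b)"
      by (simp add: xy hsT prT hsA A.scale_right m)
    show "prT (hsT [:0, 1:] a) b = - pCons 0 (prT a b)"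
      by (simp add: xy hsT prT hsA A.sesqui_left additive.minus[OF mp] pc del: minus_pCons)
    show "prT a (hsT [:0, 1:] b) = map_poly (hsT [:0, 1:]) (prT a b) + pCons 0 (prT a b)"
      by (simp add: xy hsT prT hsA A.sesqui_right additive.add[OF mp] m pc)
  qed
  interpret T: conformal_product hsT "g ` A" prT by (rule cmp)
  define M where "M = map_poly (map_poly g)"
  have M: "additive M" unfolding M_def by (intro additive_map_poly g)
  have Mc: "M [:[:v:]:] = [:[:g v:]:]" for v by (simp add: M_def map_poly_pCons g0)
  have MX: "M (lam_op u) = lam_op (M u)" "M (mu_op u) = mu_op (M u)"
    "M (lam_mu_op u) = lam_mu_op (M u)" for u
    by (simp_all add: M_def map_lam_op[OF g] map_mu_op map_lam_mu_op[OF g])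
  note addX = additive_lam_op additive_mu_op additive_lam_mu_op
  have left: "left_nested prT X Z (g x) (g y) (g z) = M (left_nested prA X' Z' x y z)"
    if "x \<in> A" "y \<in> A" "z \<in> A" 
      and X: "additive X" "additive Z" "\<And>u. M (X' u) = X (M u)" "\<And>u. M (Z' u) = Z (M u)"
    for x y z X Z X' Z'
    unfolding left_nested_def
    apply (simp add: prT that(1-3))
    apply (rule subst_op_transfer[where Q = "\<lambda>_. True", symmetric])
          apply (simp_all add: M X g0)
     apply (subst prT)
       apply (simp_all add: that A.closed)
     apply (rule subst_op_transfer[where Q = "\<lambda>_. True"])
          apply (simp_all add: M X g0 Mc)
    apply (subst T.zero_left)
     apply (use that in \<open>auto simp: subst_op_def\<close>)
    done
  have right: "right_nested prT X Y (g x) (g y) (g z) = M (right_nested prA X' Y' x y z)"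
    if "x \<in> A" "y \<in> A" "z \<in> A" 
      and X: "additive X" "additive Y" "\<And>u. M (X' u) = X (M u)" "\<And>u. M (Y' u) = Y (M u)"
    for x y z X Y X' Y'
    unfolding right_nested_def
    apply (simp add: prT that(1-3))
    apply (rule subst_op_transfer[where Q = "\<lambda>_. True", symmetric])
          apply (simp_all add: M X g0)
     apply (subst prT)
       apply (simp_all add: that A.closed)
     apply (rule subst_op_transfer[where Q = "\<lambda>_. True"])
          apply (simp_all add: M X g0 Mc)
    apply (subst T.zero_right)
     apply (use that in \<open>auto simp: subst_op_def\<close>)
    done
  have assoc: "assoc_conformal_algebra hsT (g ` A) prT"
  proof
    fix a b c assume "a \<in> g ` A" "b \<in> g ` A" "c \<in> g ` A"
    then obtain x y z where xyz: "a = g x" "b = g y" "c = g z" "x \<in> A" "y \<in> A" "z \<in> A" by auto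
    show "left_nested prT lam_op lam_mu_op a b c = right_nested prT lam_op mu_op a b c"
      unfolding xyz(1-3)
      by (subst left[where X' = lam_op and Z' = lam_mu_op], simp_all add: MX addX xyz)
        (subst right[where X' = lam_op and Y' = mu_op], simp_all add: MX addX xyz A.conformal_assoc)
  qed
  have opp: "opposite (hsT [:0, 1:]) prT (g x) (g y) = map_poly g (opposite (hsA [:0, 1:]) prA x y)"
    if "x \<in> A" "y \<in> A" for x y
    unfolding opposite_def prT[OF that(2,1)]
  proof (rule subst_op_transfer[where Q = "\<lambda>q. \<forall>i. coeff q i \<in> A", symmetric])
    show "additive (map_poly g)" by (rule additive_map_poly[OF g])
    have "additive (map_poly (hsT [:0, 1:]))"
      by (intro additive_map_poly) (simp add: additive_def T.scale_right_distrib)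
    then show "additive (\<lambda>q. - map_poly (hsT [:0, 1:]) q - pCons 0 q)"
      by (auto simp: additive_def)
    fix u :: "'a poly" assume u: "\<forall>i. coeff u i \<in> A"
    have "coeff (- map_poly (hsA [:0, 1:]) u - pCons 0 u) i \<in> A" for i
      using u A.subspace_0[OF A.subspace_C]
      by (auto simp: coeff_map_poly coeff_pCons split: nat.splits
          intro!: A.subspace_diff A.subspace_neg A.subspace_C hsA)
    moreover have "map_poly g (- map_poly (hsA [:0, 1:]) u - pCons 0 u) =
           - map_poly (hsT [:0, 1:]) (map_poly g u) - pCons 0 (map_poly g u)"
      by (intro poly_eqI)
        (simp add: coeff_map_poly coeff_pCons g0 additive.diff[OF g] additive.minus[OF g] u hsT split: nat.splits)
    ultimately show "(\<forall>i. coeff (- map_poly (hsA [:0, 1:]) u - pCons 0 u) i \<in> A) \<and>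
         map_poly g (- map_poly (hsA [:0, 1:]) u - pCons 0 u) =
           - map_poly (hsT [:0, 1:]) (map_poly g u) - pCons 0 (map_poly g u)"
      by blast
  next
    fix i show "\<forall>n. coeff [:coeff (prA y x) i:] n \<in> A"
      using that A.subspace_0[OF A.subspace_C] by (simp add: coeff_pCons A.closed split: nat.splits)
    show "map_poly g [:coeff (prA y x) i:] = [:g (coeff (prA y x) i):]"
      by (simp add: map_poly_pCons g0)
  qed (simp_all add: g0)
  have \<tau>0: "\<tau> 0 = 0"
    using conformal_homD(2)[OF hom, of 0 0] C.subspace_0[OF C.subspace_C] by simp
  have hom': "conformal_hom hsC C lb hsT (g ` A) (commutator_product hsT prT) (g \<circ> \<tau>)"
    unfolding conformal_hom_def
  proof (intro conjI ballI allI)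
    fix x y assume xy: "x \<in> C" "y \<in> C"
    note xyA = xy[THEN conformal_homD(1)[OF hom]]
    show "(g \<circ> \<tau>) (x + y) = (g \<circ> \<tau>) x + (g \<circ> \<tau>) y"
      using xy by (simp add: conformal_homD(2)[OF hom] additive.add[OF g])
    have "commutator_product hsT prT (g (\<tau> x)) (g (\<tau> y)) = map_poly g (commutator_product hsA prA (\<tau> x) (\<tau> y))"
      unfolding commutator_product_def
      by (simp add: prT opp xyA additive.diff[OF additive_map_poly[OF g]])
    then show "commutator_product hsT prT ((g \<circ> \<tau>) x) ((g \<circ> \<tau>) y) = map_poly (g \<circ> \<tau>) (lb x y)"
      by (simp add: conformal_homD(4)[OF hom] xy map_poly_map_poly g0 \<tau>0)
  qed (auto simp: conformal_homD[OF hom] hsT)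
  have gen': "S = g ` A"
    if S: "S \<subseteq> g ` A" "conformal_subalgebra hsT prT S" "(g \<circ> \<tau>) ` C \<subseteq> S" for S
  proof -
    define R where "R = {x \<in> A. g x \<in> S}"
    note subS = conformal_subalgebraD(1)[OF S(2)]
    have "conformal_subalgebra hsA prA R"
      unfolding conformal_subalgebra_def
    proof (intro conjI ballI allI)
      show "A.subspace R"
        by (rule A.subspaceI)
          (use A.subspace_0[OF A.subspace_C] T.subspace_0[OF subS] T.subspace_add[OF subS] T.subspace_scale[OF subS] in
            \<open>auto simp: R_def g0 addA hsA additive.add[OF g] hsT[symmetric]\<close>)
      fix a b n assume "a \<in> R" "b \<in> R"
      then have ab: "a \<in> A" "b \<in> A" "g a \<in> S" "g b \<in> S" by (auto simp: R_def)
      have "coeff (prT (g a) (g b)) n \<in> S" using ab conformal_subalgebraD(2)[OF S(2)] by blast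
      then show "coeff (prA a b) n \<in> R"
        using ab by (simp add: R_def A.closed prT coeff_map_poly g0)
    qed
    moreover have "\<tau> ` C \<subseteq> R" using S(3) conformal_homD(1)[OF hom] by (auto simp: R_def)
    ultimately have "R = A" by (intro gen) (auto simp: R_def)
    then show "S = g ` A" using S(1) by (auto simp: R_def)
  qed
  show ?thesis
    unfolding assoc_envelope_def using assoc hom' gen' C.lie_conformal_algebra_axioms by auto
qed


primrec monomial_value ::
  "('k::field poly \<Rightarrow> 'a::ab_group_add \<Rightarrow> 'a) \<Rightarrow> ('a \<Rightarrow> 'a \<Rightarrow> 'a poly) \<Rightarrow> ('c \<Rightarrow> 'a) \<Rightarrow>
   'c conf_monomial \<Rightarrow> 'a" where
  "monomial_value hs pr \<tau> (Gen c) = \<tau> c"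
| "monomial_value hs pr \<tau> (Der s) = hs [:0, 1:] (monomial_value hs pr \<tau> s)"
| "monomial_value hs pr \<tau> (NProd n s t) =
     coeff (pr (monomial_value hs pr \<tau> s) (monomial_value hs pr \<tau> t)) n"

lemma module_const_vector_space:
  assumes "module (hs :: 'k::field poly \<Rightarrow> 'a::ab_group_add \<Rightarrow> 'a)"
  shows "vector_space (\<lambda>k. hs [:k:])"
proof -
  interpret module hs by (rule assms)
  show ?thesis
    by standard
      (simp_all add: scale_right_distrib scale_left_distrib[symmetric] one_pCons[symmetric] mult_ac)
qed

lemma envelope_spanned_by_monomials:
  fixes hsA :: "'k::field poly \<Rightarrow> 'a::ab_group_add \<Rightarrow> 'a"
  assumes env: "assoc_envelope hsC C lb hsA A prA \<tau>"
  defines "\<tau>' \<equiv> \<lambda>c. if c \<in> C then \<tau> c else 0"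
  shows "module.span (\<lambda>k. hsA [:k:]) (range (monomial_value hsA prA \<tau>')) = A"
proof -
  interpret A: assoc_conformal_algebra hsA A prA using env by (simp add: assoc_envelope_def)
  interpret V: vector_space "\<lambda>k. hsA [:k:]"
    by (rule module_const_vector_space) (rule A.module_axioms)
  have hom: "conformal_hom hsC C lb hsA A (commutator_product hsA prA) \<tau>"
    and gen: "\<And>S. S \<subseteq> A \<Longrightarrow> conformal_subalgebra hsA prA S \<Longrightarrow> \<tau> ` C \<subseteq> S \<Longrightarrow> S = A"
    using env by (auto simp: assoc_envelope_def)
  define ev where "ev = monomial_value hsA prA \<tau>'"
  have ev_simps: "ev (Gen c) = \<tau>' c" "ev (Der s) = hsA [:0, 1:] (ev s)"
    "ev (NProd n s t) = coeff (prA (ev s) (ev t)) n" for c s t n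
    by (simp_all add: ev_def)
  have hsA: "x \<in> A \<Longrightarrow> hsA p x \<in> A" for x p
    using A.subspace_C by (simp add: A.subspace_scale)
  have evA: "ev m \<in> A" for m
    by (induction m)
      (auto simp: ev_simps \<tau>'_def hsA A.closed A.subspace_0[OF A.subspace_C] conformal_homD(1)[OF hom])
  have subA: "V.subspace A"
    using A.subspace_C by (auto simp: V.subspace_def A.subspace_def)
  define S where "S = V.span (range ev)"
  have SA: "S \<subseteq> A" unfolding S_def by (rule V.span_minimal) (auto simp: evA subA)
  have subS: "V.subspace S" unfolding S_def by simp
  have der: "hsA [:0, 1:] x \<in> S" if "x \<in> S" for x
    using that unfolding S_def
  proof (induction rule: V.span_induct_alt)
    case (step c x y)
    from step(1) obtain m where "x = ev m" by auto
    then have "hsA [:0, 1:] x = ev (Der m)" by (simp add: ev_simps)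
    then have "hsA [:0, 1:] x \<in> V.span (range ev)" by (auto intro: V.span_base)
    moreover have "hsA [:0, 1:] (hsA [:c:] x + y) = hsA [:c:] (hsA [:0, 1:] x) + hsA [:0, 1:] y"
      by (simp add: A.scale_right_distrib mult.commute)
    ultimately show ?case using step(2) by (metis V.span_add V.span_scale)
  qed (simp add: V.span_zero)
  have hsS: "hsA p x \<in> S" if "x \<in> S" for p x
    using that
  proof (induction p arbitrary: x)
    case 0
    then show ?case using V.subspace_0[OF subS] by simp
  next
    case (pCons a p)
    have "pCons a p = [:a:] + [:0, 1:] * p" by simp
    then have "hsA (pCons a p) x = hsA [:a:] x + hsA [:0, 1:] (hsA p x)"
      by (metis A.scale_left_distrib A.scale_scale)
    then show ?case
      using V.subspace_add[OF subS] V.subspace_scale[OF subS] der[OF pCons.IH] pCons.prems by metis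
  qed
  have coeff1: "coeff (prA x (ev t)) n \<in> S" if "x \<in> S" for x t n
  proof -
    have "x \<in> A \<and> coeff (prA x (ev t)) n \<in> S"
      using that unfolding S_def
    proof (induction rule: V.span_induct_alt)
      case base
      then show ?case by (simp add: A.zero_left evA V.span_zero A.subspace_0[OF A.subspace_C])
    next
      case (step c x y)
      from step(1) obtain s where s: "x = ev s" by auto
      have "coeff (prA x (ev t)) n = ev (NProd n s t)" by (simp add: ev_simps s)
      then have "coeff (prA x (ev t)) n \<in> V.span (range ev)" by (auto intro: V.span_base)
      moreover have "coeff (prA (hsA [:c:] x + y) (ev t)) n =
          hsA [:c:] (coeff (prA x (ev t)) n) + coeff (prA y (ev t)) n"
        using step(2) by (simp add: A.add_left A.scale_left evA s hsA coeff_map_poly)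
      ultimately show ?case
        using step(2) by (simp add: V.span_add V.span_scale A.subspace_add[OF A.subspace_C] hsA evA s)
    qed
    then show ?thesis ..
  qed
  have coeff2: "coeff (prA x y) n \<in> S" if x: "x \<in> S" and y: "y \<in> S" for x y n
  proof -
    have xA: "x \<in> A" using x SA by auto
    have "y \<in> A \<and> coeff (prA x y) n \<in> S"
      using y unfolding S_def
    proof (induction rule: V.span_induct_alt)
      case base
      then show ?case by (simp add: A.zero_right xA V.span_zero A.subspace_0[OF A.subspace_C])
    next
      case (step c y z)
      from step(1) obtain t where t: "y = ev t" by auto
      have "coeff (prA x y) n \<in> V.span (range ev)"
        using coeff1[OF x] by (simp add: S_def t)
      moreover have "coeff (prA x (hsA [:c:] y + z)) n =
          hsA [:c:] (coeff (prA x y) n) + coeff (prA x z) n"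
        using step(2) by (simp add: A.add_right A.scale_right evA xA t hsA coeff_map_poly)
      ultimately show ?case
        using step(2) by (simp add: V.span_add V.span_scale A.subspace_add[OF A.subspace_C] hsA evA t)
    qed
    then show ?thesis ..
  qed
  have "S = A"
  proof (rule gen[OF SA])
    show "conformal_subalgebra hsA prA S"
      unfolding conformal_subalgebra_def
      using V.subspace_0[OF subS] V.subspace_add[OF subS] hsS coeff2 by (auto simp: A.subspace_def)
    show "\<tau> ` C \<subseteq> S"
    proof
      fix x assume "x \<in> \<tau> ` C"
      then obtain c where "c \<in> C" "x = ev (Gen c)" by (auto simp: ev_simps \<tau>'_def)
      then show "x \<in> S" by (auto simp: S_def intro: V.span_base)
    qed
  qed
  then show ?thesis by (simp add: S_def ev_def)
qed


theorem universal_envelope_property: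
  fixes hsC :: "'k::field poly \<Rightarrow> 'c::ab_group_add \<Rightarrow> 'c"
    and hsU :: "'k poly \<Rightarrow> 'u::ab_group_add \<Rightarrow> 'u"
    and hsA :: "'k poly \<Rightarrow> 'a::ab_group_add \<Rightarrow> 'a"
  assumes univ: "universal_assoc_envelope hsC C lb B N hsU U prU \<tau>U"
    and env: "assoc_envelope hsC C lb hsA A prA \<tau>"
    and loc: "\<And>a b. a \<in> B \<Longrightarrow> b \<in> B \<Longrightarrow> locality prA (\<tau> a) (\<tau> b) \<le> N a b"
  shows "\<exists>\<phi>. conformal_hom hsU U prU hsA A prA \<phi> \<and> (\<forall>c\<in>C. \<tau> c = \<phi> (\<tau>U c))"
proof -
  interpret A: assoc_conformal_algebra hsA A prA using env by (simp add: assoc_envelope_def)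
  interpret V: vector_space "\<lambda>k. hsA [:k:]"
    by (rule module_const_vector_space) (rule A.module_axioms)
  define sT :: "'k \<Rightarrow> ('c conf_monomial \<Rightarrow> 'k) \<Rightarrow> ('c conf_monomial \<Rightarrow> 'k)" where "sT = (\<lambda>k f m. k * f m)"
  interpret T: vector_space sT
    by standard (auto simp: sT_def algebra_simps fun_eq_iff)
  interpret VT: vector_space_pair "\<lambda>k. hsA [:k:]" sT ..
  define \<tau>' where "\<tau>' = (\<lambda>c. if c \<in> C then \<tau> c else 0)"
  define ev where "ev = monomial_value hsA prA \<tau>'"
  have span_ev: "V.span (range ev) = A"
    unfolding ev_def \<tau>'_def by (rule envelope_spanned_by_monomials[OF env])
  obtain Bs where Bs: "Bs \<subseteq> range ev" "V.independent Bs" "range ev \<subseteq> V.span Bs"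
    by (rule V.maximal_independent_subset)
  have span_Bs: "V.span Bs = A"
    using span_ev Bs by (metis V.span_mono V.span_span subset_antisym)
  define E where "E = V.extend_basis Bs"
  have E: "V.independent E" "V.span E = UNIV" "Bs \<subseteq> E"
    using Bs(2) by (simp_all add: E_def V.independent_extend_basis V.extend_basis_superset)
  define g where "g x m = V.representation E x (ev m)" for x m
  have lin_g: "Vector_Spaces.linear (\<lambda>k. hsA [:k:]) sT g"
    by unfold_locales
      (auto simp: g_def sT_def fun_eq_iff E V.representation_add V.representation_scale)
  have inj_g: "inj_on g A"
  proof (rule inj_onI)
    fix x y assume xy: "x \<in> A" "y \<in> A" "g x = g y"
    have repr: "V.representation E z = V.representation Bs z" if "z \<in> A" for z
      using V.representation_extend[OF E(1) _ E(3)] that span_Bs by simp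
    have "V.representation Bs x b = V.representation Bs y b" for b
    proof (cases "b \<in> Bs")
      case True
      then obtain m where "b = ev m" using Bs(1) by auto
      then show ?thesis using fun_cong[OF xy(3), of m] by (simp add: g_def repr xy(1,2))
    next
      case False
      then show ?thesis using V.representation_ne_zero by metis
    qed
    then have eq: "V.representation Bs x = V.representation Bs y" ..
    have "x = (\<Sum>b | V.representation Bs x b \<noteq> 0. hsA [:V.representation Bs x b:] b)"
      by (rule V.sum_nonzero_representation_eq[OF Bs(2), symmetric]) (use xy(1) span_Bs in blast)
    also have "\<dots> = (\<Sum>b | V.representation Bs y b \<noteq> 0. hsA [:V.representation Bs y b:] b)"
      by (simp only: eq)
    also have "\<dots> = y"
      by (rule V.sum_nonzero_representation_eq[OF Bs(2)]) (use xy(2) span_Bs in blast)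
    finally show "x = y" .
  qed
  have subA: "V.subspace A"
    using A.subspace_C by (auto simp: V.subspace_def A.subspace_def)
  obtain r where r: "range r \<subseteq> A" "Vector_Spaces.linear sT (\<lambda>k. hsA [:k:]) r"
    "\<And>x. x \<in> A \<Longrightarrow> r (g x) = x"
    using VT.linear_exists_left_inverse_on[OF lin_g subA inj_g] by blast
  interpret g: Vector_Spaces.linear "\<lambda>k. hsA [:k:]" sT g by (rule lin_g)
  interpret r: Vector_Spaces.linear sT "\<lambda>k. hsA [:k:]" r by (rule r(2))
  have rA: "r t \<in> A" for t using r(1) by auto
  have hsA: "x \<in> A \<Longrightarrow> hsA p x \<in> A" for x p
    using A.subspace_C by (simp add: A.subspace_scale)
  define hsT where "hsT p t = g (hsA p (r t)) + sT (coeff p 0) (t - g (r t))" for p t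
  have r_hsT: "r (hsT p t) = hsA p (r t)" for p t
    by (simp add: hsT_def r.add r.scale r.diff r(3) rA hsA)
  have modT: "module hsT"
  proof
    fix p q :: "'k poly" and s t
    show "hsT p (s + t) = hsT p s + hsT p t"
      by (simp add: hsT_def r.add g.add A.scale_right_distrib T.scale_right_distrib T.scale_right_diff_distrib)
    show "hsT (p + q) t = hsT p t + hsT q t"
      by (simp add: hsT_def g.add A.scale_left_distrib T.scale_left_distrib)
    have "hsT q t - g (r (hsT q t)) = sT (coeff q 0) (t - g (r t))"
      by (simp add: r_hsT) (simp add: hsT_def)
    then show "hsT p (hsT q t) = hsT (p * q) t"
      by (simp add: hsT_def[of p] r_hsT) (simp add: hsT_def coeff_mult_0)
    show "hsT 1 t = t" by (simp add: hsT_def)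
  qed
  define prT where "prT = (\<lambda>s t. map_poly g (prA (r s) (r t)))"
  have add: "additive g" "additive r" by (simp_all add: additive_def g.add r.add)
  have envT: "assoc_envelope hsC C lb hsT (g ` A) prT (g \<circ> \<tau>)"
    unfolding prT_def
    by (rule transport_envelope[OF env add rA r(3) modT]) (simp_all add: hsT_def r(3))
  have hom\<tau>: "c \<in> C \<Longrightarrow> \<tau> c \<in> A" for c
    using env by (auto simp: assoc_envelope_def dest: conformal_homD(1))
  have BC: "B \<subseteq> C" using univ by (simp add: universal_assoc_envelope_def)
  have "locality prT ((g \<circ> \<tau>) a) ((g \<circ> \<tau>) b) \<le> N a b" if "a \<in> B" "b \<in> B" for a b
  proof -
    have "locality prT ((g \<circ> \<tau>) a) ((g \<circ> \<tau>) b) \<le> locality prA (\<tau> a) (\<tau> b)"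
      using that[THEN subsetD[OF BC]] by (auto simp: locality_def prT_def r(3) hom\<tau> map_poly_degree_leq)
    then show ?thesis using loc[OF that] by simp
  qed
  then obtain \<phi> where \<phi>: "conformal_hom hsU U prU hsT (g ` A) prT \<phi>"
    "\<And>c. c \<in> C \<Longrightarrow> (g \<circ> \<tau>) c = \<phi> (\<tau>U c)"
    using univ envT unfolding universal_assoc_envelope_def by blast
  interpret U: assoc_conformal_algebra hsU U prU
    using univ by (simp add: universal_assoc_envelope_def assoc_envelope_def)
  have \<phi>0: "\<phi> 0 = 0"
    using conformal_homD(2)[OF \<phi>(1), of 0 0] U.subspace_0[OF U.subspace_C] by simp
  have "conformal_hom hsU U prU hsA A prA (r \<circ> \<phi>)"
    unfolding conformal_hom_def
  proof (intro conjI ballI allI)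
    fix x y assume xy: "x \<in> U" "y \<in> U"
    show "(r \<circ> \<phi>) (x + y) = (r \<circ> \<phi>) x + (r \<circ> \<phi>) y"
      by (simp add: conformal_homD(2)[OF \<phi>(1)] xy r.add)
    have "map_poly \<phi> (prU x y) = map_poly g (prA (r (\<phi> x)) (r (\<phi> y)))"
      using conformal_homD(4)[OF \<phi>(1) xy] by (simp add: prT_def)
    then have "map_poly r (map_poly \<phi> (prU x y)) = map_poly r (map_poly g (prA (r (\<phi> x)) (r (\<phi> y))))"
      by simp
    also have "\<dots> = prA (r (\<phi> x)) (r (\<phi> y))"
      by (intro poly_eqI) (simp add: coeff_map_poly r(3) A.closed rA)
    finally show "prA ((r \<circ> \<phi>) x) ((r \<circ> \<phi>) y) = map_poly (r \<circ> \<phi>) (prU x y)"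
      by (simp add: map_poly_map_poly \<phi>0)
  qed (auto simp: rA r_hsT conformal_homD(3)[OF \<phi>(1)])
  moreover have "\<tau> c = (r \<circ> \<phi>) (\<tau>U c)" if "c \<in> C" for c
    using \<phi>(2)[OF that] r(3)[OF hom\<tau>[OF that]] by simp
  ultimately show ?thesis by blast
qed


section \<open>The quadratic bracket is a Lie conformal algebra structure\<close>


lemma subst_op_0: "e 0 = 0 \<Longrightarrow> subst_op X e 0 = 0"
  by (simp add: subst_op_def)

lemma subst_op_pCons:
  fixes X :: "'b::ab_group_add \<Rightarrow> 'b"
  assumes X: "additive X" and e: "e 0 = 0"
  shows "subst_op X e (pCons a p) = e a + X (subst_op X e p)"
proof -
  have "subst_op X e (pCons a p) = (\<Sum>i\<le>Suc (degree p). (X ^^ i) (e (coeff (pCons a p) i)))"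
    by (rule subst_op_eq_sum) (auto simp: X e degree_pCons_le)
  also have "\<dots> = e a + (\<Sum>i\<le>degree p. X ((X ^^ i) (e (coeff p i))))"
    by (subst sum.atMost_Suc_shift) simp
  also have "\<dots> = e a + X (subst_op X e p)"
    by (simp add: subst_op_def additive.sum[OF X])
  finally show ?thesis .
qed

lemma subst_op_add:
  fixes X :: "'b::ab_group_add \<Rightarrow> 'b"
  assumes X: "additive X" and e: "additive e"
  shows "additive (subst_op X e)"
proof (rule additive.intro)
  fix p q :: "'a poly"
  define n where "n = max (degree p) (degree q)"
  have n: "degree p \<le> n" "degree q \<le> n" "degree (p + q) \<le> n"
    by (auto simp: n_def degree_add_le_max)
  have eq: "subst_op X e r = (\<Sum>i\<le>n. (X ^^ i) (e (coeff r i)))" if "degree r \<le> n" for r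
    by (rule subst_op_eq_sum) (use X additive.zero[OF e] that in auto)
  show "subst_op X e (p + q) = subst_op X e p + subst_op X e q"
    by (simp add: eq[OF n(1)] eq[OF n(2)] eq[OF n(3)]
        additive.add[OF e] additive.add[OF additive_funpow[OF X]] sum.distrib)
qed

lemma subst_op_add_fun:
  fixes X :: "'b::ab_group_add \<Rightarrow> 'b"
  assumes X: "additive X"
  shows "subst_op X (\<lambda>u. e u + e' u) p = subst_op X e p + subst_op X e' p"
  unfolding subst_op_def by (simp add: additive.add[OF additive_funpow[OF X]] sum.distrib)

lemma subst_op_commute:
  fixes X :: "'b::ab_group_add \<Rightarrow> 'b"
  assumes "additive F" "additive X" "\<And>u. F (X u) = X (F u)" "\<And>u. F (e u) = e' (f u)" "f 0 = 0" "e' 0 = 0"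
  shows "subst_op X e' (map_poly f p) = F (subst_op X e p)"
  by (rule subst_op_transfer[where Q = "\<lambda>_. True", symmetric]) (use assms in auto)

lemma subst_op_commute_id:
  fixes X :: "'b::ab_group_add \<Rightarrow> 'b"
  assumes "additive F" "additive X" "\<And>u. F (X u) = X (F u)" "\<And>u. e' u = F (e u)" "e 0 = 0"
  shows "subst_op X e' p = F (subst_op X e p)"
  using subst_op_commute[of F X e e' "\<lambda>x. x" p] assms by (simp add: additive.zero[OF assms(1)])

lemma additive_uminus: "additive F \<Longrightarrow> additive (\<lambda>x. - F x)"
  by (simp add: additive_def)

lemma additive_plus: "additive F \<Longrightarrow> additive F' \<Longrightarrow> additive (\<lambda>x. F x + F' x)"
  by (simp add: additive_def)

lemma additive_pCons: "additive (pCons 0)" by (simp add: additive_def)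

lemma poly_additive_zero:
  assumes J: "additive J" and T: "\<And>f. J (pCons 0 f) = T (J f)" "T 0 = 0" and "\<And>a. J [:a:] = 0"
  shows "J (f :: 'a::ab_group_add poly) = (0 :: 'b::ab_group_add)"
proof (induction f)
  case 0
  then show ?case by (simp add: additive.zero[OF J])
next
  case (pCons a f)
  have "pCons a f = [:a:] + pCons 0 f" by simp
  then have "J (pCons a f) = J [:a:] + J (pCons 0 f)" by (metis additive.add[OF J])
  then show ?case by (simp add: assms pCons.IH)
qed

lemma free_scale_simps:
  assumes "vector_space scale"
  shows "free_scale scale [:k:] f = map_poly (scale k) f"
    "free_scale scale [:0, 1:] f = pCons 0 f"
    "free_scale scale 0 f = 0"
    "free_scale scale (pCons k p) f = map_poly (scale k) f + pCons 0 (free_scale scale p f)"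
proof -
  interpret vector_space scale by fact
  have z: "map_poly (scale 0) g = 0" "map_poly (scale 1) g = g" for g by (intro poly_eqI, simp add: coeff_map_poly)+
  note simps = free_scale_def subst_op_0 subst_op_pCons additive_pCons z
  show "free_scale scale [:k:] f = map_poly (scale k) f"
    "free_scale scale [:0, 1:] f = pCons 0 f"
    "free_scale scale 0 f = 0"
    "free_scale scale (pCons k p) f = map_poly (scale k) f + pCons 0 (free_scale scale p f)"
    by (simp_all add: simps)
qed

lemma module_free_scale:
  assumes "vector_space (scale :: 'k::field \<Rightarrow> 'v::ab_group_add \<Rightarrow> 'v)"
  shows "module (free_scale scale)"
proof -
  interpret vector_space scale by fact
  note fs = free_scale_simps[OF assms]
  have add: "additive (scale k)" for k by (simp add: additive_def scale_right_distrib)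
  have addm: "map_poly (scale k) (f + g) = map_poly (scale k) f + map_poly (scale k) g" for k f g
    by (rule additive.add[OF additive_map_poly[OF add]])
  have addk: "map_poly (scale (k + l)) f = map_poly (scale k) f + map_poly (scale l) f" for k l f
    by (intro poly_eqI) (simp add: coeff_map_poly scale_left_distrib)
  have mpC: "map_poly (scale k) (pCons 0 f) = pCons 0 (map_poly (scale k) f)" for k f
    by (simp add: map_poly_pCons)
  have mm: "map_poly (scale k) (map_poly (scale l) f) = map_poly (scale (k * l)) f" for k l f
    by (intro poly_eqI) (simp add: coeff_map_poly)
  have addl: "free_scale scale (p + q) f = free_scale scale p f + free_scale scale q f" for p q f
  proof (induction p arbitrary: q)
    case (pCons a p)
    then show ?case by (cases q) (simp add: fs addk)
  qed (simp add: fs)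
  have addr: "free_scale scale p (f + g) = free_scale scale p f + free_scale scale p g" for p f g
    by (induction p) (simp_all add: fs addm)
  have sm: "free_scale scale (smult k p) f = map_poly (scale k) (free_scale scale p f)" for k p f
    by (induction p) (simp_all add: fs addm mpC mm)
  have pc: "free_scale scale p (pCons 0 f) = pCons 0 (free_scale scale p f)" for p f
    by (induction p) (simp_all add: fs mpC)
  have 1: "map_poly (scale 1) f = f" "map_poly (scale 0) f = 0" for f by (intro poly_eqI, simp add: coeff_map_poly)+
  show ?thesis
  proof
    fix p q f
    show "free_scale scale p (free_scale scale q f) = free_scale scale (p * q) f"
      by (induction p) (simp_all add: fs addl sm 1)
    show "free_scale scale 1 f = f" by (simp add: one_pCons fs 1)
  qed (auto simp: addl addr)
qed

lemma quadratic_lie_conformal: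
  fixes scale :: "'k::field \<Rightarrow> 'v::ab_group_add \<Rightarrow> 'v"
  assumes "gelfand_dorfman_algebra scale circ br"
  shows "lie_conformal_algebra (free_scale scale) UNIV (quadratic_bracket circ br)"
    and "module.span (free_scale scale) (range (\<lambda>v. [:v:])) = UNIV"
proof -
  interpret gelfand_dorfman_algebra scale circ br by fact
  have vs: "vector_space scale" by unfold_locales
  interpret H: module "free_scale scale" by (rule module_free_scale[OF vs])
  note fs = free_scale_simps[OF vs]
  have D: "free_scale scale [:0, 1:] = pCons 0" by (rule ext) (rule fs(2))
  have K: "free_scale scale [:k:] = map_poly (scale k)" for k by (rule ext) (simp add: fs)
  define Q where "Q = quadratic_bracket circ br"
  define G where "G = quadratic_generator_bracket circ br"
  define Lm :: "'v poly poly \<Rightarrow> 'v poly poly" where "Lm = (\<lambda>P. - pCons 0 P)"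
  define Rm :: "'v poly poly \<Rightarrow> 'v poly poly" where "Rm = (\<lambda>P. map_poly (pCons 0) P + pCons 0 P)"
  interpret cl: Vector_Spaces.linear scale scale "\<lambda>x. circ x y" for y
    by (rule novikov_algebra.axioms(1)[THEN bilinear_algebra.linear_left]) unfold_locales
  interpret cr: Vector_Spaces.linear scale scale "circ x" for x
    by (rule novikov_algebra.axioms(1)[THEN bilinear_algebra.linear_right]) unfold_locales
  interpret bl: Vector_Spaces.linear scale scale "\<lambda>x. br x y" for y
    by (rule lie_algebra.axioms(1)[THEN bilinear_algebra.linear_left]) unfold_locales
  interpret br: Vector_Spaces.linear scale scale "br x" for x
    by (rule lie_algebra.axioms(1)[THEN bilinear_algebra.linear_right]) unfold_locales
  have mD: "additive (map_poly (pCons 0 :: 'v poly \<Rightarrow> _))" by (intro additive_map_poly additive_pCons)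
  have Lm: "additive Lm" by (simp add: Lm_def additive_def)
  have Rm: "additive Rm" by (simp add: Rm_def additive_def additive.add[OF mD])
  have Qeq: "Q f g = subst_op Lm (\<lambda>a. subst_op Rm (G a) g) f" for f g
    by (simp add: Q_def quadratic_bracket_def Lm_def Rm_def G_def)
  have Gl: "additive (\<lambda>a. G a b)" and Gr: "additive (G a)" for a b
    by (auto simp: G_def quadratic_generator_bracket_def additive_def cl.add cr.add bl.add br.add ac_simps)
  have G0: "G 0 b = 0" "G a 0 = 0" for a b using additive.zero[OF Gl] additive.zero[OF Gr] by auto
  have il: "additive (\<lambda>a. subst_op Rm (G a) g)" for g
  proof (rule additive.intro)
    fix x y
    have "G (x + y) = (\<lambda>b. G x b + G y b)" by (rule ext) (rule additive.add[OF Gl])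
    then show "subst_op Rm (G (x + y)) g = subst_op Rm (G x) g + subst_op Rm (G y) g"
      by (simp add: subst_op_add_fun[OF Rm])
  qed
  have Ql: "additive (\<lambda>f. Q f g)" for g
    unfolding Qeq by (rule subst_op_add[OF Lm il])
  have Qr: "additive (Q f)" for f
    by (rule additive.intro)
      (simp add: Qeq additive.add[OF subst_op_add[OF Rm Gr]] subst_op_add_fun[OF Lm])
  have Rm_commute: "map_poly (pCons 0) (Lm P) = Lm (map_poly (pCons 0) P)" "Rm (Lm P) = Lm (Rm P)" for P
    by (simp_all add: Lm_def Rm_def additive.minus[OF mD] map_poly_pCons)
  have QDl: "Q (pCons 0 f) g = - pCons 0 (Q f g)" for f g
    by (simp add: Qeq subst_op_pCons[OF Lm] additive.zero[OF il] del: minus_pCons) (simp add: Lm_def)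
  have QDr: "Q f (pCons 0 g) = map_poly (pCons 0) (Q f g) + pCons 0 (Q f g)" for f g
  proof -
    have "Q f (pCons 0 g) = subst_op Lm (\<lambda>a. Rm (subst_op Rm (G a) g)) f"
      by (simp add: Qeq subst_op_pCons[OF Rm] G0)
    also have "\<dots> = Rm (Q f g)"
      unfolding Qeq by (rule subst_op_commute_id) (auto simp: Rm Lm Rm_commute additive.zero[OF il])
    finally show ?thesis by (simp add: Rm_def)
  qed
  define K2 :: "'k \<Rightarrow> 'v poly poly \<Rightarrow> 'v poly poly" where "K2 k = map_poly (map_poly (scale k))" for k
  have addK: "additive (scale k)" for k by (simp add: additive_def scale_right_distrib)
  have K2: "additive (K2 k)" for k unfolding K2_def by (intro additive_map_poly addK)
  have K2_Lm: "K2 k (Lm P) = Lm (K2 k P)" for k P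
    by (simp add: Lm_def additive.minus[OF K2] del: minus_pCons) (simp add: K2_def map_poly_pCons)
  have K2_Rm: "K2 k (Rm P) = Rm (K2 k P)" for k P
  proof -
    have "K2 k (map_poly (pCons 0) P) = map_poly (pCons 0) (K2 k P)"
      by (intro poly_eqI) (simp add: K2_def coeff_map_poly map_poly_pCons)
    moreover have "K2 k (pCons 0 P) = pCons 0 (K2 k P)" by (simp add: K2_def map_poly_pCons)
    ultimately show ?thesis by (simp add: Rm_def additive.add[OF K2])
  qed
  have K2G: "G (scale k a) b = K2 k (G a b)" "G a (scale k b) = K2 k (G a b)" for k a b
    by (simp_all add: G_def quadratic_generator_bracket_def K2_def map_poly_pCons cl.scale cr.scale
        bl.scale br.scale scale_right_distrib)
  have Kr: "subst_op Rm (G a) (map_poly (scale k) g) = K2 k (subst_op Rm (G a) g)" for a g k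
    by (rule subst_op_commute) (simp_all add: K2 Rm K2_Rm K2G G0)
  have Kl: "subst_op Rm (G (scale k a)) g = K2 k (subst_op Rm (G a) g)" for a g k
    by (rule subst_op_commute_id) (simp_all add: K2 Rm K2_Rm K2G G0)
  have QKr: "Q f (map_poly (scale k) g) = K2 k (Q f g)" for f g k
    unfolding Qeq Kr by (rule subst_op_commute_id) (simp_all add: K2 Lm K2_Lm additive.zero[OF il])
  have QKl: "Q (map_poly (scale k) f) g = K2 k (Q f g)" for f g k
    unfolding Qeq by (rule subst_op_commute) (simp_all add: K2 Lm K2_Lm Kl additive.zero[OF il])
  have QG: "Q [:a:] [:b:] = G a b" for a b
    by (simp add: Qeq subst_op_pCons[OF Lm] subst_op_pCons[OF Rm] additive.zero[OF il] G0 subst_op_0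
        additive.zero[OF Lm] additive.zero[OF Rm])
  have Q0: "Q 0 f = 0" "Q f 0 = 0" for f using additive.zero[OF Ql] additive.zero[OF Qr] by auto

  define N :: "'v poly poly \<Rightarrow> 'v poly poly" where "N = (\<lambda>q. - map_poly (pCons 0) q - pCons 0 q)"
  have N: "additive N" by (simp add: N_def additive_def additive.add[OF mD])
  define c1 :: "'v poly \<Rightarrow> 'v poly poly" where "c1 = (\<lambda>v. [:v:])"
  have c1: "additive c1" "c1 0 = 0" by (simp_all add: c1_def additive_def)
  define Op where "Op P = subst_op N c1 P" for P
  have Op: "additive Op" unfolding Op_def by (rule subst_op_add[OF N c1(1)])
  have OpL: "Op (pCons 0 P) = N (Op P)" for P by (simp add: Op_def subst_op_pCons[OF N] c1)
  have OpD: "Op (map_poly (pCons 0) P) = map_poly (pCons 0) (Op P)" for P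
    unfolding Op_def
  proof (rule subst_op_commute)
    show "map_poly (pCons 0) (N u) = N (map_poly (pCons 0) u)" for u
      by (simp add: N_def additive.diff[OF mD] additive.minus[OF mD] map_poly_pCons)
  qed (simp_all add: mD N c1 c1_def map_poly_pCons)
  define S where "S f g = Q f g + Op (Q g f)" for f g
  have S: "S f g = 0" for f g
  proof (rule poly_additive_zero[where J = "\<lambda>f. S f g" and T = "\<lambda>P. - pCons 0 P"])
    fix a
    show "S [:a:] g = 0"
    proof (rule poly_additive_zero[where J = "S [:a:]" and T = Rm])
      fix b
      have ba: "br b a = - br a b" 
      proof -
        have "br (a + b) (a + b) = 0" "br a a = 0" "br b b = 0" by (rule alternating)+
        then have "br a b + br b a = 0" by (simp add: bl.add br.add add.commute)
        then show ?thesis by (metis add_eq_0_iff)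
      qed
      show "S [:a:] [:b:] = 0"
        by (simp add: S_def QG G_def quadratic_generator_bracket_def Op_def subst_op_pCons[OF N] c1 subst_op_0 additive.zero[OF N])
           (simp add: N_def c1_def map_poly_pCons ba)
    qed (auto simp: S_def additive_def additive.add[OF Qr] additive.add[OF Ql] additive.add[OF Op] additive.zero[OF Rm]
       QDl QDr Rm_def additive.minus[OF Op] OpL N_def additive.add[OF mD] additive.add[OF additive_pCons] simp del: minus_pCons add_pCons)
  qed (auto simp: S_def additive_def additive.add[OF Qr] additive.add[OF Ql] additive.add[OF Op] 
       QDl QDr OpL OpD N_def additive.add[OF additive_pCons] simp del: minus_pCons add_pCons)

  define c2 :: "'v poly \<Rightarrow> 'v poly poly poly" where "c2 = (\<lambda>v. [:[:v:]:])"
  have c2: "additive c2" "c2 0 = 0" by (simp_all add: c2_def additive_def)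
  define D2 :: "'v poly poly poly \<Rightarrow> 'v poly poly poly" where "D2 = map_poly (map_poly (pCons 0))"
  have D2: "additive D2" unfolding D2_def by (intro additive_map_poly mD)
  let ?X = "lam_op :: 'v poly poly poly \<Rightarrow> 'v poly poly poly"
  let ?Y = "mu_op :: 'v poly poly poly \<Rightarrow> 'v poly poly poly"
  let ?Z = "lam_mu_op :: 'v poly poly poly \<Rightarrow> 'v poly poly poly"
  note addX = additive_lam_op additive_mu_op additive_lam_mu_op
  have XY: "?X (?Y P) = ?Y (?X P)" for P by (simp add: lam_op_def mu_op_def map_poly_pCons)
  have XZ: "?X (?Z P) = ?Z (?X P)" for P
    by (simp add: lam_mu_op_def XY additive.add[OF additive_lam_op])
  have D2X: "D2 (?X P) = ?X (D2 P)" "D2 (?Y P) = ?Y (D2 P)" "D2 (?Z P) = ?Z (D2 P)" for P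
    unfolding D2_def by (simp_all add: map_lam_op map_mu_op map_lam_mu_op additive_pCons)
  have D2c: "D2 (c2 v) = c2 (pCons 0 v)" for v by (simp add: D2_def c2_def map_poly_pCons)
  have sub: "additive (subst_op Z c2)" "subst_op Z c2 (pCons 0 P) = Z (subst_op Z c2 P)"
    "subst_op Z c2 (map_poly (pCons 0) P) = D2 (subst_op Z c2 P)" if "Z = ?X \<or> Z = ?Y \<or> Z = ?Z" for Z P
  proof -
    have Z: "additive Z" "\<And>u. D2 (Z u) = Z (D2 u)" using that D2X addX by auto
    show "additive (subst_op Z c2)" by (rule subst_op_add[OF Z(1) c2(1)])
    show "subst_op Z c2 (pCons 0 P) = Z (subst_op Z c2 P)" by (simp add: subst_op_pCons[OF Z(1)] c2)
    show "subst_op Z c2 (map_poly (pCons 0) P) = D2 (subst_op Z c2 P)"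
      by (rule subst_op_commute) (auto simp: Z D2 D2c c2)
  qed
  define L where "L f g h = left_nested Q ?X ?Z f g h" for f g h
  define R where "R X Y f g h = right_nested Q X Y f g h" for X Y f g h
  have Leq: "L f g h = subst_op ?X (\<lambda>u. subst_op ?Z c2 (Q u h)) (Q f g)" for f g h
    by (simp add: L_def left_nested_def c2_def)
  have Req: "R X Y f g h = subst_op Y (\<lambda>u. subst_op X c2 (Q f u)) (Q g h)" for X Y f g h
    by (simp add: R_def right_nested_def c2_def)
  have eL: "additive (\<lambda>u. subst_op ?Z c2 (Q u h))" for h
    by (rule additive.intro) (simp add: additive.add[OF sub(1)] additive.add[OF Ql])
  have eR: "additive (\<lambda>u. subst_op X c2 (Q f u))" if "X = ?X \<or> X = ?Y \<or> X = ?Z" for f X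
    by (rule additive.intro) (simp add: additive.add[OF sub(1)[OF that]] additive.add[OF Qr])
  have L_add: "additive (\<lambda>f. L f g h)" "additive (\<lambda>g. L f g h)" "additive (\<lambda>h. L f g h)" for f g h
    by (rule additive.intro, simp add: Leq additive.add[OF subst_op_add[OF addX(1) eL]] additive.add[OF sub(1)]
       additive.add[OF Ql] additive.add[OF Qr] subst_op_add_fun[OF addX(1)])+
  have L1: "L (pCons 0 f) g h = - ?X (L f g h)" for f g h
    by (simp add: Leq QDl additive.minus[OF subst_op_add[OF addX(1) eL]] subst_op_pCons[OF addX(1)] Q0 subst_op_0 c2 del: minus_pCons)
  have L2: "L f (pCons 0 g) h = - ?Y (L f g h)" for f g h
  proof -
    have "subst_op ?X (\<lambda>u. subst_op ?Z c2 (Q u h)) (map_poly (pCons 0) (Q f g)) = - ?Z (L f g h)"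
      unfolding Leq
      by (rule subst_op_commute[where F = "\<lambda>P. - ?Z P"])
        (simp_all add: QDl additive.minus[OF sub(1)] additive.minus[OF addX(1)] additive.minus[OF addX(3)]
           additive.add[OF addX(3)] sub(2) XZ Q0 subst_op_0 c2 addX additive_uminus additive_plus D2 del: minus_pCons)
    then show ?thesis
      by (simp add: Leq QDr additive.add[OF subst_op_add[OF addX(1) eL]] subst_op_pCons[OF addX(1)] Q0 subst_op_0 c2 lam_mu_op_def)
  qed
  have L3: "L f g (pCons 0 h) = D2 (L f g h) + ?X (L f g h) + ?Y (L f g h)" for f g h
  proof -
    have "L f g (pCons 0 h) = D2 (L f g h) + ?Z (L f g h)"
      unfolding Leq
      by (rule subst_op_commute_id[where F = "\<lambda>P. D2 P + ?Z P"])
        (simp_all add: QDr additive.add[OF sub(1)] additive.add[OF addX(1)] additive.add[OF addX(3)]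
           additive.add[OF D2] sub XZ D2X Q0 subst_op_0 c2 addX additive_uminus additive_plus D2)
    then show ?thesis by (simp add: lam_mu_op_def)
  qed
  have R_facts: "additive (\<lambda>f. R X Y f g h)" "additive (\<lambda>g. R X Y f g h)" "additive (\<lambda>h. R X Y f g h)"
    "R X Y (pCons 0 f) g h = - X (R X Y f g h)"
    "R X Y f (pCons 0 g) h = - Y (R X Y f g h)"
    "R X Y f g (pCons 0 h) = D2 (R X Y f g h) + X (R X Y f g h) + Y (R X Y f g h)"
    if XY': "X = ?X \<and> Y = ?Y \<or> X = ?Y \<and> Y = ?X" for X Y f g h
  proof -
    have X: "X = ?X \<or> X = ?Y \<or> X = ?Z" "additive X" "additive Y" "\<And>P. X (Y P) = Y (X P)"
      "\<And>P. D2 (X P) = X (D2 P)" "\<And>P. D2 (Y P) = Y (D2 P)"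
      using XY' XY addX D2X by auto
    note eR' = eR[OF X(1)] and sub' = sub[OF X(1)]
    show "additive (\<lambda>f. R X Y f g h)" "additive (\<lambda>g. R X Y f g h)" "additive (\<lambda>h. R X Y f g h)"
      by (rule additive.intro, simp add: Req additive.add[OF subst_op_add[OF X(3) eR']] additive.add[OF sub'(1)]
       additive.add[OF Ql] additive.add[OF Qr] subst_op_add_fun[OF X(3)])+
    show "R X Y (pCons 0 f) g h = - X (R X Y f g h)"
      unfolding Req
      by (rule subst_op_commute_id[where F = "\<lambda>P. - X P"])
        (simp_all add: QDl additive.minus[OF sub'(1)] additive.minus[OF X(3)] 
           additive.add[OF X(2)] sub' X(2-6) Q0 subst_op_0 c2 additive_uminus additive_plus D2 del: minus_pCons)
    show "R X Y f (pCons 0 g) h = - Y (R X Y f g h)"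
      by (simp add: Req QDl additive.minus[OF subst_op_add[OF X(3) eR']] subst_op_pCons[OF X(3)] Q0 subst_op_0 c2 del: minus_pCons)
    have "subst_op Y (\<lambda>u. subst_op X c2 (Q f u)) (map_poly (pCons 0) (Q g h)) = D2 (R X Y f g h) + X (R X Y f g h)"
      unfolding Req
      by (rule subst_op_commute[where F = "\<lambda>P. D2 P + X P"])
        (simp_all add: QDr additive.add[OF sub'(1)] additive.add[OF X(2)] additive.add[OF X(3)] additive.add[OF D2]
           sub' X(2-6) Q0 subst_op_0 c2 additive_uminus additive_plus D2)
    then show "R X Y f g (pCons 0 h) = D2 (R X Y f g h) + X (R X Y f g h) + Y (R X Y f g h)"
      by (simp add: Req QDr additive.add[OF subst_op_add[OF X(3) eR']] subst_op_pCons[OF X(3)] Q0 subst_op_0 c2)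
  qed
  define J where "J f g h = L f g h - R ?X ?Y f g h + R ?Y ?X g f h" for f g h
  have J_gen: "J [:a:] [:b:] [:c:] = 0" for a b c
  proof -
    have Qs: "Q [:u, v:] [:w:] = G u w - pCons 0 (G v w)"
      "Q [:w:] [:u, v:] = G w u + map_poly (pCons 0) (G w v) + pCons 0 (G w v)" for u v w
    proof -
      have uv: "[:u, v:] = [:u:] + pCons 0 [:v:]" by simp
      show "Q [:u, v:] [:w:] = G u w - pCons 0 (G v w)"
        unfolding uv additive.add[OF Ql] QDl QG by simp
      show "Q [:w:] [:u, v:] = G w u + map_poly (pCons 0) (G w v) + pCons 0 (G w v)"
        unfolding uv additive.add[OF Qr] QDr QG by simp
    qed
    have X0: "?X 0 = 0" "?Y 0 = 0" "?Z 0 = 0" by (rule additive.zero, rule addX)+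
    have Xp: "?X (pCons p P) = pCons (pCons 0 p) (?X P)" "?Y P = pCons 0 P" "?Z P = ?X P + ?Y P" for p P
      by (simp_all add: lam_op_def mu_op_def map_poly_pCons lam_mu_op_def)
    have an: "br x y = - br y x" for x y
    proof -
      have "br (x + y) (x + y) = 0" "br x x = 0" "br y y = 0" by (rule alternating)+
      then have "br x y + br y x = 0" by (simp add: bl.add br.add add.commute)
      then show ?thesis by (metis add_eq_0_iff2)
    qed
    have flip: "br b a = - br a b" "br c a = - br a c" "br c b = - br b c"
      "br (circ x y) z = - br z (circ x y)" "br (br x y) z = - br z (br x y)" for x y z
      by (rule an)+
    have rc: "circ (circ a c) b = circ (circ a b) c" "circ (circ b c) a = circ (circ b a) c"
      "circ (circ c b) a = circ (circ c a) b"
      by (rule right_commutative)+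
    have ls: "circ a (circ b c) = circ (circ a b) c - circ (circ b a) c + circ b (circ a c)"
      "circ a (circ c b) = circ (circ a c) b - circ (circ c a) b + circ c (circ a b)"
      "circ b (circ c a) = circ (circ b c) a - circ (circ c b) a + circ c (circ b a)"
      using left_symmetric[of a b c] left_symmetric[of a c b] left_symmetric[of b c a]
      by (simp_all add: algebra_simps)
    have co: "br a (circ b c) = br c (circ b a) + circ b (br a c) - circ (br b a) c + circ (br b c) a"
      "br a (circ c b) = br b (circ c a) + circ c (br a b) - circ (br c a) b + circ (br c b) a"
      "br b (circ a c) = br c (circ a b) + circ a (br b c) - circ (br a b) c + circ (br a c) b"
      using compatible[of a b c] compatible[of a c b] compatible[of b a c]
      by (simp_all add: algebra_simps)
    have ja: "br a (br b c) = br b (br a c) - br c (br a b)"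
      using jacobi[of a b c] unfolding flip(2) br.neg by (simp add: algebra_simps)
    show ?thesis
      by (simp add: J_def Leq Req QG G_def quadratic_generator_bracket_def subst_op_pCons[OF addX(1)]
        subst_op_pCons[OF addX(2)] subst_op_pCons[OF addX(3)] subst_op_0 Q0 c2 X0 Qs map_poly_pCons,
        simp add: c2_def Xp X0,
        simp add: cl.add cr.add bl.add br.add cl.neg cr.neg bl.neg br.neg flip ja co ls rc algebra_simps)
  qed
  note Rxy = R_facts[of ?X ?Y, simplified] and Ryx = R_facts[of ?Y ?X, simplified]
  have J: "J f g h = 0" for f g h
  proof (rule poly_additive_zero[where J = "\<lambda>f. J f g h" and T = "\<lambda>P. - ?X P"])
    fix a
    show "J [:a:] g h = 0"
    proof (rule poly_additive_zero[where J = "\<lambda>g. J [:a:] g h" and T = "\<lambda>P. - ?Y P"])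
      fix b
      show "J [:a:] [:b:] h = 0"
      proof (rule poly_additive_zero[where J = "\<lambda>h. J [:a:] [:b:] h" and T = "\<lambda>P. D2 P + ?X P + ?Y P"])
        show "J [:a:] [:b:] [:c:] = 0" for c by (rule J_gen)
        show "additive (J [:a:] [:b:])"
          by (auto simp: J_def additive_def L_add[unfolded additive_def] Rxy[unfolded additive_def] Ryx[unfolded additive_def])
        show "J [:a:] [:b:] (pCons 0 f) = D2 (J [:a:] [:b:] f) + ?X (J [:a:] [:b:] f) + ?Y (J [:a:] [:b:] f)" for f
          by (simp add: J_def L3 Rxy Ryx additive.add[OF addX(1)] additive.add[OF addX(2)] additive.add[OF D2]
             additive.diff[OF addX(1)] additive.diff[OF addX(2)] additive.diff[OF D2])
      qed (simp add: additive.zero[OF addX(1)] additive.zero[OF addX(2)] additive.zero[OF D2])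
      show "additive (\<lambda>g. J [:a:] g h)"
        by (auto simp: J_def additive_def L_add[unfolded additive_def] Rxy[unfolded additive_def] Ryx[unfolded additive_def])
      show "J [:a:] (pCons 0 g) h = - ?Y (J [:a:] g h)" for g
        by (simp add: J_def L2 Rxy Ryx additive.add[OF addX(2)] additive.diff[OF addX(2)])
    qed (simp add: additive.zero[OF addX(2)])
    show "additive (\<lambda>f. J f g h)"
      by (auto simp: J_def additive_def L_add[unfolded additive_def] Rxy[unfolded additive_def] Ryx[unfolded additive_def])
    show "J (pCons 0 f) g h = - ?X (J f g h)" for f
      by (simp add: J_def L1 Rxy Ryx additive.add[OF addX(1)] additive.diff[OF addX(1)])
  qed (simp add: additive.zero[OF addX(1)])
  show "lie_conformal_algebra (free_scale scale) UNIV (quadratic_bracket circ br)"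
    unfolding Q_def[symmetric]
  proof
    fix f g h
    show "Q f g = - opposite (free_scale scale [:0, 1:]) Q f g"
      using S[of f g] by (simp add: opposite_def D S_def Op_def N_def c1_def eq_neg_iff_add_eq_0)
    show "left_nested Q lam_op lam_mu_op f g h = right_nested Q lam_op mu_op f g h - right_nested Q mu_op lam_op g f h"
      using J[of f g h] by (simp add: J_def L_def R_def algebra_simps)
  qed (auto simp: D K additive.add[OF Ql] additive.add[OF Qr] QKl QKr K2_def QDl QDr)
  show "H.span (range (\<lambda>v. [:v:])) = UNIV"
  proof -
    have "f \<in> H.span (range (\<lambda>v. [:v:]))" for f :: "'v poly"
    proof (induction f)
      case 0
      then show ?case by (rule H.span_zero)
    next
      case (pCons a f)
      have "pCons a f = [:a:] + free_scale scale [:0, 1:] f" by (simp add: D)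
      then show ?case using pCons by (metis H.span_add H.span_scale H.span_base rangeI)
    qed
    then show ?thesis by blast
  qed
qed


end

theory Submission
  imports Defs "HOL-Library.Product_Plus"
begin

text \<open>
  By the universal property it is enough to find one associative envelope of \<open>L(V)\<close> with
  locality at most 3 on \<open>V\<close> into which \<open>L(V)\<close> maps injectively.  Let \<open>V \<subseteq> P\<close> for a Poisson
  algebra \<open>P\<close> with derivation \<open>d\<close>.  The idea is that the annihilation algebra of \<open>L(V)\<close> acts by
  Hamiltonian vector fields: for \<open>a, b\<close> in \<open>V\<close> and functions \<open>f, g\<close> of a variable \<open>t\<close> its bracket is
  \<open>[a f, b g] = {a, b} f g + a d(b) f' g - b d(a) f g'\<close>, which is the Poisson bracket on
  \<open>P[t]\<close> given by the bracket of \<open>P\<close> plus \<open>\<partial>\<^sub>t \<and> d\<close>.  So \<open>a f\<close> acts as the operator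
  \<open>f {a, -} + f' a d - f d(a) \<partial>\<^sub>t\<close>.  A product of two such operators moves at most two derivatives
  onto the first function, and this is the locality bound 3.

  Here this is written in conformal language.  For an associative algebra \<open>E\<close>, the polynomials
  \<open>E[\<partial>, x]\<close> form an associative conformal algebra under
  \<open>F \<^sub>\<lambda> G = F(-\<lambda>, x) G(\<partial> + \<lambda>, x + \<lambda>)\<close> (lemma \<open>assoc_conformal_algebra_cend\<close>); the variable \<open>x\<close>
  stands for \<open>- \<partial>\<^sub>t\<close> written to the left of the functions of \<open>t\<close>.  Suppose that \<open>P\<close> is represented in
  \<open>E\<close> by elements \<open>m a\<close>, \<open>h a\<close> and \<open>D\<close> which satisfy the relations of the multiplication by \<open>a\<close>, of
  \<open>{a, -}\<close> and of \<open>d\<close>.  Then the operator above becomes \<open>h a + x m(d a) - \<partial> D m a\<close>, and a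
  computation using only those relations shows that the commutator of two such elements is
  the quadratic bracket (lemma \<open>commutator_current\<close>).

  The adjoint representation on \<open>P\<close> need not be faithful.  It is made faithful
  by adjoining a unit to \<open>P\<close> and by replacing \<open>d\<close> with \<open>d + 1\<close>, which satisfies the same commutation
  relations: applied to the unit, \<open>m(d a)\<close> gives \<open>d a\<close> and \<open>D m a\<close> gives \<open>d a + a\<close>, so
  both vanish only for \<open>a = 0\<close> (lemma \<open>exists_faithful_representation\<close>).
\<close>

section \<open>Linear and bilinear maps\<close>

lemma linear_additive: "Vector_Spaces.linear s t f \<Longrightarrow> additive f"
  by (rule additive.intro) (rule module_hom.add[OF module_hom_linearI])

lemma linear_scale: "Vector_Spaces.linear s t f \<Longrightarrow> f (s k x) = t k (f x)"
  by (rule module_hom.scale[OF module_hom_linearI])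

lemma (in bilinear_algebra) additive_mul: "additive (\<lambda>x. mul x y)" "additive (mul x)"
  by (rule linear_additive[OF linear_left], rule linear_additive[OF linear_right])

lemma (in bilinear_algebra) mul_scale:
  "mul (scale k x) y = scale k (mul x y)" "mul x (scale k y) = scale k (mul x y)"
  using linear_scale[OF linear_left[of y]] linear_scale[OF linear_right[of x]] by auto

lemma (in lie_algebra) anticommute: "br y x = - br x y"
proof -
  have "br (x + y) (x + y) = 0" "br x x = 0" "br y y = 0" by (rule alternating)+
  then have "br x y + br y x = 0"
    by (simp add: additive.add[OF additive_mul(1)] additive.add[OF additive_mul(2)] add.commute)
  then show ?thesis by (simp add: eq_neg_iff_add_eq_0 add.commute)
qed

lemma linearI:
  assumes "vector_space s" "vector_space t" "\<And>x y. f (x + y) = f x + f y" "\<And>k x. f (s k x) = t k (f x)"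
  shows "Vector_Spaces.linear s t f"
  using assms by (simp add: Vector_Spaces.linear_iff)

section \<open>Substitution in two variables\<close>


definition subst2 ::
  "('b \<Rightarrow> 'b) \<Rightarrow> ('b \<Rightarrow> 'b) \<Rightarrow> ('a::zero \<Rightarrow> 'b::comm_monoid_add) \<Rightarrow> 'a poly poly \<Rightarrow> 'b" where
  "subst2 Y X c F = subst_op Y (subst_op X c) F"

lemma additive_subst2:
  fixes X Y :: "'b::ab_group_add \<Rightarrow> 'b"
  assumes "additive Y" "additive X" "additive c"
  shows "additive (subst2 Y X c)"
  unfolding subst2_def by (intro subst_op_add assms)

lemma subst2_const:
  fixes X Y :: "'b::ab_group_add \<Rightarrow> 'b"
  assumes "additive Y" "additive X" "additive c"
  shows "subst2 Y X c [:[:e:]:] = c e"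
  using assms by (simp add: subst2_def subst_op_pCons subst_op_0 additive.zero)

lemma subst2_outer:
  fixes X Y :: "'b::ab_group_add \<Rightarrow> 'b"
  assumes "additive Y" "additive X" "additive c"
  shows "subst2 Y X c (pCons 0 F) = Y (subst2 Y X c F)"
  using assms by (simp add: subst2_def subst_op_pCons subst_op_0 additive.zero)

lemma subst2_inner:
  fixes X Y :: "'b::ab_group_add \<Rightarrow> 'b"
  assumes "additive Y" "additive X" "additive c" "\<And>u. X (Y u) = Y (X u)"
  shows "subst2 Y X c (map_poly (pCons 0) F) = X (subst2 Y X c F)"
  unfolding subst2_def using assms
  by (intro subst_op_commute) (auto simp: subst_op_pCons subst_op_0 additive.zero)

lemma subst2_add_fun:
  fixes X Y :: "'b::ab_group_add \<Rightarrow> 'b"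
  assumes "additive Y" "additive X"
  shows "subst2 Y X (\<lambda>e. c e + c' e) F = subst2 Y X c F + subst2 Y X c' F"
proof -
  have "subst_op X (\<lambda>e. c e + c' e) = (\<lambda>p. subst_op X c p + subst_op X c' p)"
    by (rule ext) (rule subst_op_add_fun[OF assms(2)])
  then show ?thesis by (simp add: subst2_def subst_op_add_fun[OF assms(1)])
qed

lemma subst2_commute:
  fixes X Y :: "'b::ab_group_add \<Rightarrow> 'b"
  assumes T: "additive T" "\<And>u. T (X u) = X (T u)" "\<And>u. T (Y u) = Y (T u)"
    and Y: "additive Y" and X: "additive X" and c: "additive c"
  shows "subst2 Y X (\<lambda>e. T (c e)) F = T (subst2 Y X c F)"
  unfolding subst2_def
  by (rule subst_op_commute_id[OF T(1) Y T(3)])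
     (auto simp: subst_op_0 additive.zero[OF c] intro!: subst_op_commute_id T X)

text \<open>
  Identities of products on \<open>E[\<partial>, x]\<close> are proved by this principle: if both sides are additive
  and obey the same rule for multiplying an argument by either variable, then their
  difference vanishes as soon as it vanishes on constants.
\<close>

lemma poly_poly_additive_zero:
  assumes J: "additive J"
    and outer: "\<And>F. J (pCons 0 F) = S (J F)" "S 0 = 0"
    and inner: "\<And>F. J (map_poly (pCons 0) F) = T (J F)" "T 0 = 0"
    and const: "\<And>e. J [:[:e:]:] = 0"
  shows "J (F :: 'a::ab_group_add poly poly) = (0 :: 'b::ab_group_add)"
proof (rule poly_additive_zero[OF J outer])
  show "J [:f:] = 0" for f :: "'a poly"
  proof (rule poly_additive_zero[where J = "\<lambda>f. J [:f:]" and T = T])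
    show "additive (\<lambda>f. J [:f:])"
      using additive.add[OF J, of "[:_:]" "[:_:]"] by (simp add: additive_def)
    show "J [:pCons 0 g:] = T (J [:g:])" for g
      using inner(1)[of "[:g:]"] by (simp add: map_poly_pCons)
  qed (use inner const in auto)
qed

section \<open>The conformal algebra of polynomials over an associative algebra\<close>

locale assoc_algebra = bilinear_algebra scale mul
  for scale :: "'k::field \<Rightarrow> 'e::ab_group_add \<Rightarrow> 'e"
    and mul :: "'e \<Rightarrow> 'e \<Rightarrow> 'e" (infixl "\<star>" 70) +
  assumes mul_assoc: "(a \<star> b) \<star> c = a \<star> (b \<star> c)"

text \<open>
  This is \<open>F(-\<lambda>, x) G(\<partial> + \<lambda>, x + \<lambda>)\<close>, with \<open>\<partial>\<close> the outer and \<open>x\<close> the inner variable of \<open>F\<close> and \<open>G\<close>,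
  and \<open>\<lambda>\<close> the outermost variable of the result.  For \<open>E\<close> the algebra of \<open>n \<times> n\<close> matrices it is the
  conformal algebra \<open>Cend\<^sub>n\<close>.
\<close>

definition cend_product ::
  "('e::ab_group_add \<Rightarrow> 'e \<Rightarrow> 'e) \<Rightarrow> 'e poly poly \<Rightarrow> 'e poly poly \<Rightarrow> 'e poly poly poly" where
  "cend_product mul F G =
     subst2 (\<lambda>Q. - pCons 0 Q) (map_poly (map_poly (pCons 0)))
       (\<lambda>e. subst2 (\<lambda>Q. map_poly (pCons 0) Q + pCons 0 Q)
                   (\<lambda>Q. map_poly (map_poly (pCons 0)) Q + pCons 0 Q)
                   (\<lambda>e'. [:[:[:mul e e':]:]:]) G) F"

context assoc_algebra
begin

lemma additive_scale: "additive (scale k)"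
  by (simp add: additive_def scale_right_distrib)

abbreviation Q where "Q \<equiv> cend_product mul"

text \<open>
  These rules determine the product, and from here on only they are used.
\<close>

lemma cend_product_rules:
  shows "additive (\<lambda>F. Q F G)" and "additive (Q F)"
    and "Q (pCons 0 F) G = - pCons 0 (Q F G)"
    and "Q (map_poly (pCons 0) F) G = map_poly (map_poly (pCons 0)) (Q F G)"
    and "Q F (pCons 0 G) = map_poly (pCons 0) (Q F G) + pCons 0 (Q F G)"
    and "Q F (map_poly (pCons 0) G) = map_poly (map_poly (pCons 0)) (Q F G) + pCons 0 (Q F G)"
    and "Q [:[:e:]:] [:[:e':]:] = [:[:[:e \<star> e':]:]:]"
proof -
  (* Y1, X1 replace the variables of F, and Y2, X2 those of G; all four commute. *)
  define Y1 :: "'e poly poly poly \<Rightarrow> _" where "Y1 = (\<lambda>Q. - pCons 0 Q)"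
  define X1 :: "'e poly poly poly \<Rightarrow> _" where "X1 = map_poly (map_poly (pCons 0))"
  define Y2 :: "'e poly poly poly \<Rightarrow> _" where "Y2 = (\<lambda>Q. map_poly (pCons 0) Q + pCons 0 Q)"
  define X2 :: "'e poly poly poly \<Rightarrow> _" where "X2 = (\<lambda>Q. map_poly (map_poly (pCons 0)) Q + pCons 0 Q)"
  define c where "c = (\<lambda>e e'. [:[:[:e \<star> e':]:]:])"
  have mD: "additive (map_poly (pCons 0) :: 'e poly poly poly \<Rightarrow> _)"
    by (intro additive_map_poly additive_pCons)
  have X1: "additive X1" unfolding X1_def by (intro additive_map_poly additive_pCons)
  have Y1: "additive Y1" unfolding Y1_def by (intro additive_uminus additive_pCons)
  have X2: "additive X2" unfolding X2_def
    by (intro additive_plus additive_pCons additive_map_poly)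
  have Y2: "additive Y2" unfolding Y2_def by (intro additive_plus additive_pCons mD)
  have cr: "additive (c e)" and cl: "additive (\<lambda>e. c e e')" for e e'
    by (auto simp: c_def additive_def additive.add[OF additive_mul(1)] additive.add[OF additive_mul(2)])
  have XD: "map_poly (map_poly (pCons 0)) (map_poly (pCons 0) P) = map_poly (pCons 0) (map_poly (map_poly (pCons 0)) P)"
    for P :: "'e poly poly poly"
    by (intro poly_eqI) (simp add: coeff_map_poly map_poly_pCons)
  note mp = additive.add[OF mD] additive.minus[OF mD] additive.add[OF X1, unfolded X1_def]
    additive.minus[OF X1, unfolded X1_def]
  have com: "X1 (Y1 P) = Y1 (X1 P)" "X2 (Y2 P) = Y2 (X2 P)" "X2 (X1 P) = X1 (X2 P)" "X2 (Y1 P) = Y1 (X2 P)"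
    "Y2 (X1 P) = X1 (Y2 P)" "Y2 (Y1 P) = Y1 (Y2 P)" for P
    unfolding X1_def Y1_def X2_def Y2_def
    by (simp_all add: mp map_poly_pCons XD)
  define I where "I = (\<lambda>G e. subst2 Y2 X2 (c e) G)"
  have Q: "Q F G = subst2 Y1 X1 (I G) F" for F G
    by (simp add: cend_product_def I_def X1_def X2_def Y1_def Y2_def c_def)
  have I: "additive (I G)" for G
  proof (rule additive.intro)
    fix x y
    have "c (x + y) = (\<lambda>e. c x e + c y e)" by (rule ext) (rule additive.add[OF cl])
    then show "I G (x + y) = I G x + I G y" by (simp add: I_def subst2_add_fun X2 Y2)
  qed
  have I': "I (F + G) = (\<lambda>e. I F e + I G e)" for F G
    unfolding I_def by (rule ext) (rule additive.add[OF additive_subst2[OF Y2 X2 cr]])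
  show "additive (\<lambda>F. Q F G)" unfolding Q by (rule additive_subst2[OF Y1 X1 I])
  show "additive (Q F)" by (rule additive.intro) (simp add: Q I' subst2_add_fun[OF Y1 X1])
  show "Q (pCons 0 F) G = - pCons 0 (Q F G)"
    using subst2_outer[OF Y1 X1 I, of G F] unfolding Q Y1_def .
  show "Q (map_poly (pCons 0) F) G = map_poly (map_poly (pCons 0)) (Q F G)"
    using subst2_inner[OF Y1 X1 I com(1), of G F] unfolding Q X1_def .
  have "I (pCons 0 G) = (\<lambda>e. Y2 (I G e))"
    unfolding I_def by (rule ext) (rule subst2_outer[OF Y2 X2 cr])
  then have "Q F (pCons 0 G) = Y2 (Q F G)" by (simp add: Q subst2_commute Y2 com X1 Y1 I)
  then show "Q F (pCons 0 G) = map_poly (pCons 0) (Q F G) + pCons 0 (Q F G)" by (simp add: Y2_def)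
  have "I (map_poly (pCons 0) G) = (\<lambda>e. X2 (I G e))"
    unfolding I_def by (rule ext) (rule subst2_inner[OF Y2 X2 cr com(2)])
  then have "Q F (map_poly (pCons 0) G) = X2 (Q F G)" by (simp add: Q subst2_commute X2 com X1 Y1 I)
  then show "Q F (map_poly (pCons 0) G) = map_poly (map_poly (pCons 0)) (Q F G) + pCons 0 (Q F G)"
    by (simp add: X2_def)
  show "Q [:[:e:]:] [:[:e':]:] = [:[:[:e \<star> e':]:]:]"
    by (simp add: Q subst2_const[OF Y1 X1 I]) (simp add: I_def subst2_const[OF Y2 X2 cr], simp add: c_def)
qed

lemma vector_space_poly: "vector_space (\<lambda>k. map_poly (scale k))"
proof
  fix a b and x y :: "'e poly"
  show "map_poly (scale a) (x + y) = map_poly (scale a) x + map_poly (scale a) y"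
    by (rule additive.add[OF additive_map_poly[OF additive_scale]])
qed (auto intro!: poly_eqI simp: coeff_map_poly scale_left_distrib)

abbreviation hs where "hs \<equiv> free_scale (\<lambda>k. map_poly (scale k))"

lemma hs_simps: "hs [:k:] = map_poly (map_poly (scale k))" "hs [:0, 1:] = pCons 0"
  by (rule ext, rule free_scale_simps[OF vector_space_poly])+

lemma cend_product_scale:
  "Q (hs [:k:] F) G = map_poly (hs [:k:]) (Q F G)"
  "Q F (hs [:k:] G) = map_poly (hs [:k:]) (Q F G)"
proof -
  let ?K = "map_poly (map_poly (scale k)) :: 'e poly poly \<Rightarrow> _"
  let ?K3 = "map_poly ?K"
  let ?X = "map_poly (map_poly (pCons 0)) :: 'e poly poly poly \<Rightarrow> _"
  let ?D = "map_poly (pCons 0) :: 'e poly poly poly \<Rightarrow> _"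
  have K: "additive ?K" "additive ?K3" by (intro additive_map_poly additive_scale)+
  have XD: "additive ?X" "additive ?D" by (intro additive_map_poly additive_pCons)+
  have com: "?K (pCons 0 F) = pCons 0 (?K F)" "?K (map_poly (pCons 0) F) = map_poly (pCons 0) (?K F)"
    "?K3 (pCons 0 P) = pCons 0 (?K3 P)" "?K3 (?D P) = ?D (?K3 P)" "?K3 (?X P) = ?X (?K3 P)" for F P
    by (intro poly_eqI, simp add: coeff_map_poly map_poly_pCons coeff_pCons split: nat.splits)+
  note add = additive.add[OF K(1)] additive.add[OF K(2)] additive.diff[OF K(2)] additive.minus[OF K(2)]
    additive.diff[OF XD(1)] additive.diff[OF XD(2)]
     additive.zero[OF XD(1)] additive.zero[OF XD(2)] cend_product_rules
     additive.add[OF cend_product_rules(1)] additive.add[OF cend_product_rules(2)] com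
  have l: "Q (?K F) G - ?K3 (Q F G) = 0" for F G
  proof (rule poly_poly_additive_zero[where J = "\<lambda>F. Q (?K F) G - ?K3 (Q F G)" and S = "\<lambda>P. - pCons 0 P" and T = ?X])
    fix e
    show "Q (?K [:[:e:]:]) G - ?K3 (Q [:[:e:]:] G) = 0"
    proof (rule poly_poly_additive_zero[where J = "\<lambda>G. Q (?K [:[:e:]:]) G - ?K3 (Q [:[:e:]:] G)"
           and S = "\<lambda>P. ?D P + pCons 0 P" and T = "\<lambda>P. ?X P + pCons 0 P"])
    qed (auto simp: add mul_scale map_poly_pCons additive_def)
  qed (auto simp: add additive_def)
  have r: "Q F (?K G) - ?K3 (Q F G) = 0" for F G
  proof (rule poly_poly_additive_zero[where J = "\<lambda>F. Q F (?K G) - ?K3 (Q F G)" and S = "\<lambda>P. - pCons 0 P" and T = ?X])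
    fix e
    show "Q [:[:e:]:] (?K G) - ?K3 (Q [:[:e:]:] G) = 0"
    proof (rule poly_poly_additive_zero[where J = "\<lambda>G. Q [:[:e:]:] (?K G) - ?K3 (Q [:[:e:]:] G)"
           and S = "\<lambda>P. ?D P + pCons 0 P" and T = "\<lambda>P. ?X P + pCons 0 P"])
    qed (auto simp: add mul_scale map_poly_pCons additive_def)
  qed (auto simp: add additive_def)
  show "Q (hs [:k:] F) G = map_poly (hs [:k:]) (Q F G)" "Q F (hs [:k:] G) = map_poly (hs [:k:]) (Q F G)"
    using l[of F G] r[of F G] by (simp_all add: hs_simps)
qed

lemma conformal_product_cend: "conformal_product hs UNIV Q"
proof -
  interpret H: module hs by (rule module_free_scale[OF vector_space_poly])
  show ?thesis
    by standard (auto simp: hs_simps(2) cend_product_scale cend_product_rules(3,5)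
      additive.add[OF cend_product_rules(1)] additive.add[OF cend_product_rules(2)])
qed

text \<open>
  Both nested products are trilinear, and the variables act on them in the same way: multiplying the
  first argument by \<open>\<partial>\<close> and \<open>x\<close> acts as \<open>-\<lambda>\<close> and \<open>x\<close>, the second as \<open>-\<mu>\<close> and \<open>x + \<lambda>\<close>, and the third as
  \<open>\<partial> + \<lambda> + \<mu>\<close> and \<open>x + \<lambda> + \<mu>\<close>.  On constants they agree because \<open>E\<close> is associative.
\<close>

lemma assoc_conformal_algebra_cend: "assoc_conformal_algebra hs UNIV Q"
proof -
  interpret CP: conformal_product hs UNIV Q by (rule conformal_product_cend)
  (* M g applies g to the coefficients of a polynomial in \<lambda>, \<mu>; thus M ?d and M ?x are the
     multiplications by \<partial> and x there. *)
  define c2 :: "'e poly poly \<Rightarrow> 'e poly poly poly poly" where "c2 = (\<lambda>v. [:[:v:]:])"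
  have c2: "additive c2" by (simp add: c2_def additive_def)
  let ?d = "pCons 0 :: 'e poly poly \<Rightarrow> 'e poly poly"
  let ?x = "map_poly (pCons 0) :: 'e poly poly \<Rightarrow> 'e poly poly"
  define M :: "('e poly poly \<Rightarrow> 'e poly poly) \<Rightarrow> 'e poly poly poly poly \<Rightarrow> 'e poly poly poly poly"
    where "M g = map_poly (map_poly g)" for g
  let ?lam = "lam_op :: 'e poly poly poly poly \<Rightarrow> 'e poly poly poly poly"
  let ?mu = "mu_op :: 'e poly poly poly poly \<Rightarrow> 'e poly poly poly poly"
  let ?lm = "lam_mu_op :: 'e poly poly poly poly \<Rightarrow> 'e poly poly poly poly"
  have add_dx: "additive ?d" "additive ?x" by (intro additive_map_poly additive_pCons)+
  have M: "additive (M g)" if "additive g" for g unfolding M_def by (intro additive_map_poly that)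
  have Mc: "M g (c2 v) = c2 (g v)" if "additive g" for g v
    using additive.zero[OF that] by (simp add: M_def c2_def map_poly_pCons)
  have MW: "M g (?lam P) = ?lam (M g P)" "M g (?mu P) = ?mu (M g P)" "M g (?lm P) = ?lm (M g P)"
    if "additive g" for g P
    unfolding M_def by (simp_all add: map_lam_op map_mu_op map_lam_mu_op that)
  note addW = additive_lam_op additive_mu_op additive_lam_mu_op
  have lam_mu: "?lam (?mu P) = ?mu (?lam P)" for P by (simp add: lam_op_def mu_op_def map_poly_pCons)
  then have lam_lm: "?lam (?lm P) = ?lm (?lam P)" for P
    by (simp add: lam_mu_op_def additive.add[OF addW(1)])
  define S where "S W = subst_op W c2" for W :: "'e poly poly poly poly \<Rightarrow> 'e poly poly poly poly"
  have S: "additive (S W)" "S W (pCons 0 P) = W (S W P)" if "additive W" for W P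
    unfolding S_def by (rule subst_op_add[OF that c2])
      (simp add: subst_op_pCons[OF that] additive.zero[OF c2])
  have SM: "S W (map_poly g P) = M g (S W P)" if "additive W" "additive g" "\<And>P. M g (W P) = W (M g P)" for W g P
    unfolding S_def
    by (rule subst_op_commute) (use that in \<open>auto simp: M Mc additive.zero[OF c2] additive.zero\<close>)
  note Sl = S[OF addW(1)] SM[OF addW(1) add_dx(1) MW(1)[OF add_dx(1)]] SM[OF addW(1) add_dx(2) MW(1)[OF add_dx(2)]]
  note Slm = S[OF addW(3)] SM[OF addW(3) add_dx(1) MW(3)[OF add_dx(1)]] SM[OF addW(3) add_dx(2) MW(3)[OF add_dx(2)]]
  note Qs = cend_product_rules(3-6) additive.add[OF cend_product_rules(1)] additive.add[OF cend_product_rules(2)]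
    additive.zero[OF cend_product_rules(1)] additive.zero[OF cend_product_rules(2)]
  note W_simps = additive.add[OF addW(1)] additive.add[OF addW(2)] additive.add[OF addW(3)]
    additive.minus[OF addW(1)] additive.minus[OF addW(2)] additive.minus[OF addW(3)]
    additive.diff[OF addW(1)] additive.diff[OF addW(2)] additive.diff[OF addW(3)]
    additive.zero[OF addW(1)] additive.zero[OF addW(2)] additive.zero[OF addW(3)]
    additive.add[OF M[OF add_dx(1)]] additive.add[OF M[OF add_dx(2)]]
    additive.minus[OF M[OF add_dx(1)]] additive.minus[OF M[OF add_dx(2)]]
    additive.diff[OF M[OF add_dx(1)]] additive.diff[OF M[OF add_dx(2)]]
    additive.zero[OF M[OF add_dx(1)]] additive.zero[OF M[OF add_dx(2)]]
    MW[OF add_dx(1)] MW[OF add_dx(2)] lam_mu lam_lm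
    additive.add[OF Sl(1)] additive.add[OF Slm(1)] additive.minus[OF Sl(1)] additive.minus[OF Slm(1)]
    additive.zero[OF Sl(1)] additive.zero[OF Slm(1)]
  define eL where "eL H u = S ?lm (Q u H)" for H u
  define eR where "eR F u = S ?lam (Q F u)" for F u
  define L where "L F G H = subst_op ?lam (eL H) (Q F G)" for F G H
  define R where "R F G H = subst_op ?mu (eR F) (Q G H)" for F G H
  have L_eq: "left_nested Q ?lam ?lm F G H = L F G H"
    and R_eq: "right_nested Q ?lam ?mu F G H = R F G H" for F G H
    by (simp_all add: L_def R_def left_nested_def right_nested_def eL_def[abs_def] eR_def[abs_def] S_def c2_def)
  have eL: "additive (eL H)" and eR: "additive (eR F)" for F H
    by (simp_all add: additive_def eL_def eR_def Qs W_simps)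
  have eL0: "eL H 0 = 0" "eR F 0 = 0" for F H using additive.zero[OF eL] additive.zero[OF eR] by auto
  have eL_rules: "eL (H + H') = (\<lambda>u. eL H u + eL H' u)"
    "eL H (?d u) = - ?lm (eL H u)" "eL H (?x u) = M ?x (eL H u)"
    "eL (?d H) = (\<lambda>u. M ?d (eL H u) + ?lm (eL H u))" "eL (?x H) = (\<lambda>u. M ?x (eL H u) + ?lm (eL H u))" for H H' u
    by (simp_all add: eL_def fun_eq_iff Qs W_simps Slm del: minus_pCons)
  have eR_rules: "eR (F + F') = (\<lambda>u. eR F u + eR F' u)"
    "eR (?d F) = (\<lambda>u. - ?lam (eR F u))" "eR (?x F) = (\<lambda>u. M ?x (eR F u))"
    "eR F (?d u) = M ?d (eR F u) + ?lam (eR F u)" "eR F (?x u) = M ?x (eR F u) + ?lam (eR F u)" for F F' u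
    by (simp_all add: eR_def fun_eq_iff Qs W_simps Sl del: minus_pCons)
  note addL = subst_op_add[OF addW(1) eL] and addR = subst_op_add[OF addW(2) eR]
  have transL: "subst_op ?lam (eL H) (map_poly g P) = F (subst_op ?lam (eL H) P)"
    if "additive F" "\<And>u. F (?lam u) = ?lam (F u)" "\<And>u. F (eL H u) = eL H (g u)" "g 0 = 0" for g F H P
    by (rule subst_op_commute) (use that in \<open>auto simp: addW eL0\<close>)
  have transR: "subst_op ?mu (eR H) (map_poly g P) = F (subst_op ?mu (eR H) P)"
    if "additive F" "\<And>u. F (?mu u) = ?mu (F u)" "\<And>u. F (eR H u) = eR H (g u)" "g 0 = 0" for g F H P
    by (rule subst_op_commute) (use that in \<open>auto simp: addW eL0\<close>)
  have L_rules: "L (F + F') G H = L F G H + L F' G H" "L F (G + G') H = L F G H + L F G' H"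
    "L F G (H + H') = L F G H + L F G H'"
    "L (?d F) G H = - ?lam (L F G H)" "L (?x F) G H = M ?x (L F G H)"
    "L F (?d G) H = - ?mu (L F G H)" "L F (?x G) H = M ?x (L F G H) + ?lam (L F G H)"
    "L F G (?d H) = M ?d (L F G H) + ?lm (L F G H)" "L F G (?x H) = M ?x (L F G H) + ?lm (L F G H)"
    for F F' G G' H H'
  proof -
    note adds = additive.add[OF addL] additive.minus[OF addL] Qs
    have lc: "subst_op ?lam (eL H) (pCons 0 P) = ?lam (subst_op ?lam (eL H) P)" for P H
      by (simp add: subst_op_pCons[OF addW(1)] eL0)
    have t: "subst_op ?lam (eL H) (map_poly ?d P) = - ?lm (subst_op ?lam (eL H) P)"
      "subst_op ?lam (eL H) (map_poly ?x P) = M ?x (subst_op ?lam (eL H) P)" for P H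
      by (rule transL[where F = "\<lambda>P. - ?lm P"] transL,
          auto simp: additive_def W_simps eL_rules simp del: minus_pCons)+
    show "L (F + F') G H = L F G H + L F' G H" "L F (G + G') H = L F G H + L F G' H"
      by (simp_all add: L_def adds)
    show "L F G (H + H') = L F G H + L F G H'"
      by (simp add: L_def eL_rules(1) subst_op_add_fun[OF addW(1)])
    show "L (?d F) G H = - ?lam (L F G H)" by (simp add: L_def adds lc del: minus_pCons)
    show "L (?x F) G H = M ?x (L F G H)" by (simp add: L_def adds t)
    show "L F (?d G) H = - ?mu (L F G H)" by (simp add: L_def adds t lc) (simp add: lam_mu_op_def)
    show "L F (?x G) H = M ?x (L F G H) + ?lam (L F G H)" by (simp add: L_def adds t lc)
    show "L F G (?d H) = M ?d (L F G H) + ?lm (L F G H)"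
      unfolding L_def eL_rules(4) Qs
      by (rule subst_op_commute_id[where F = "\<lambda>P. M ?d P + ?lm P"])
        (auto simp: W_simps addW eL0 additive_def)
    show "L F G (?x H) = M ?x (L F G H) + ?lm (L F G H)"
      unfolding L_def eL_rules(5) Qs
      by (rule subst_op_commute_id[where F = "\<lambda>P. M ?x P + ?lm P"])
        (auto simp: W_simps addW eL0 additive_def)
  qed
  have R_rules: "R (F + F') G H = R F G H + R F' G H" "R F (G + G') H = R F G H + R F G' H"
    "R F G (H + H') = R F G H + R F G H'"
    "R (?d F) G H = - ?lam (R F G H)" "R (?x F) G H = M ?x (R F G H)"
    "R F (?d G) H = - ?mu (R F G H)" "R F (?x G) H = M ?x (R F G H) + ?lam (R F G H)"
    "R F G (?d H) = M ?d (R F G H) + ?lm (R F G H)" "R F G (?x H) = M ?x (R F G H) + ?lm (R F G H)"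
    for F F' G G' H H'
  proof -
    note adds = additive.add[OF addR] additive.minus[OF addR] Qs
    have lc: "subst_op ?mu (eR F) (pCons 0 P) = ?mu (subst_op ?mu (eR F) P)" for P F
      by (simp add: subst_op_pCons[OF addW(2)] eL0)
    have t: "subst_op ?mu (eR F) (map_poly ?d P) = M ?d (subst_op ?mu (eR F) P) + ?lam (subst_op ?mu (eR F) P)"
      "subst_op ?mu (eR F) (map_poly ?x P) = M ?x (subst_op ?mu (eR F) P) + ?lam (subst_op ?mu (eR F) P)" for P F
      by (rule transR[where F = "\<lambda>P. M ?d P + ?lam P"] transR[where F = "\<lambda>P. M ?x P + ?lam P"],
          auto simp: additive_def W_simps eR_rules)+
    show "R F (G + G') H = R F G H + R F G' H" "R F G (H + H') = R F G H + R F G H'"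
      by (simp_all add: R_def adds)
    show "R (F + F') G H = R F G H + R F' G H"
      by (simp add: R_def eR_rules(1) subst_op_add_fun[OF addW(2)])
    show "R F (?d G) H = - ?mu (R F G H)" by (simp add: R_def adds lc del: minus_pCons)
    show "R F (?x G) H = M ?x (R F G H) + ?lam (R F G H)" by (simp add: R_def adds t)
    show "R F G (?d H) = M ?d (R F G H) + ?lm (R F G H)" by (simp add: R_def adds t lc) (simp add: lam_mu_op_def)
    show "R F G (?x H) = M ?x (R F G H) + ?lm (R F G H)" by (simp add: R_def adds t lc) (simp add: lam_mu_op_def)
    show "R (?d F) G H = - ?lam (R F G H)"
      unfolding R_def eR_rules(2)
      by (rule subst_op_commute_id[where F = "\<lambda>P. - ?lam P"])
        (auto simp: W_simps addW eL0 additive_def)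
    show "R (?x F) G H = M ?x (R F G H)"
      unfolding R_def eR_rules(3)
      by (rule subst_op_commute_id) (auto simp: W_simps addW eL0 additive_def)
  qed
  have const: "L [:[:a:]:] [:[:b:]:] [:[:c:]:] = R [:[:a:]:] [:[:b:]:] [:[:c:]:]" for a b c
    by (simp add: L_def R_def cend_product_rules(7) subst_op_pCons addW subst_op_0 eL0 W_simps)
       (simp add: eL_def eR_def cend_product_rules(7) S_def subst_op_pCons addW subst_op_0 additive.zero[OF c2] mul_assoc W_simps)
  note rules = L_rules R_rules
  have "L F G H - R F G H = 0" for F G H
  proof (rule poly_poly_additive_zero[where J = "\<lambda>F. L F G H - R F G H" and S = "\<lambda>P. - ?lam P" and T = "M ?x"])
    fix a
    show "L [:[:a:]:] G H - R [:[:a:]:] G H = 0"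
    proof (rule poly_poly_additive_zero[where J = "\<lambda>G. L [:[:a:]:] G H - R [:[:a:]:] G H" and S = "\<lambda>P. - ?mu P"
          and T = "\<lambda>P. M ?x P + ?lam P"])
      fix b
      show "L [:[:a:]:] [:[:b:]:] H - R [:[:a:]:] [:[:b:]:] H = 0"
        by (rule poly_poly_additive_zero[where J = "\<lambda>H. L [:[:a:]:] [:[:b:]:] H - R [:[:a:]:] [:[:b:]:] H"
            and S = "\<lambda>P. M ?d P + ?lm P" and T = "\<lambda>P. M ?x P + ?lm P"])
          (simp_all add: additive_def rules W_simps const)
    qed (simp_all add: additive_def rules W_simps)
  qed (simp_all add: additive_def rules W_simps)
  then show ?thesis
    by unfold_locales (simp add: L_eq R_eq)
qed

end

section \<open>Homomorphisms from a quadratic Lie conformal algebra\<close>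

lemma quadratic_bracket_rules:
  fixes scale :: "'k::field \<Rightarrow> 'v::ab_group_add \<Rightarrow> 'v"
  assumes "gelfand_dorfman_algebra scale circ br"
  defines "Q \<equiv> quadratic_bracket circ br"
  shows "additive (\<lambda>f. Q f g)" and "additive (Q f)"
    and "Q (pCons 0 f) g = - pCons 0 (Q f g)"
    and "Q f (pCons 0 g) = map_poly (pCons 0) (Q f g) + pCons 0 (Q f g)"
    and "Q [:a:] [:b:] = quadratic_generator_bracket circ br a b"
proof -
  interpret gelfand_dorfman_algebra scale circ br by fact
  have "bilinear_algebra scale circ" "bilinear_algebra scale br" by unfold_locales
  note circ = this[THEN bilinear_algebra.additive_mul(1)] this[THEN bilinear_algebra.additive_mul(2)]
  define G where "G = quadratic_generator_bracket circ br"
  define Lm :: "'v poly poly \<Rightarrow> 'v poly poly" where "Lm = (\<lambda>P. - pCons 0 P)"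
  define Rm :: "'v poly poly \<Rightarrow> 'v poly poly" where "Rm = (\<lambda>P. map_poly (pCons 0) P + pCons 0 P)"
  have mD: "additive (map_poly (pCons 0 :: 'v poly \<Rightarrow> _))" by (intro additive_map_poly additive_pCons)
  have Lm: "additive Lm" unfolding Lm_def by (intro additive_uminus additive_pCons)
  have Rm: "additive Rm" unfolding Rm_def by (intro additive_plus additive_pCons mD)
  have com: "Rm (Lm P) = Lm (Rm P)" for P
    by (simp add: Lm_def Rm_def additive.minus[OF mD] map_poly_pCons)
  define I where "I = (\<lambda>g a. subst_op Rm (G a) g)"
  have Q: "Q f g = subst_op Lm (I g) f" for f g
    by (simp add: Q_def quadratic_bracket_def Lm_def Rm_def G_def I_def)
  have Gr: "additive (G a)" and Gl: "G (a + a') = (\<lambda>b. G a b + G a' b)" for a a'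
    by (auto simp: G_def quadratic_generator_bracket_def additive_def fun_eq_iff
        circ[THEN additive.add])
  have I: "additive (I g)" for g
    by (simp add: additive_def I_def Gl subst_op_add_fun[OF Rm])
  have I': "I (f + g) = (\<lambda>a. I f a + I g a)" for f g
    by (simp add: I_def additive.add[OF subst_op_add[OF Rm Gr]])
  show "additive (\<lambda>f. Q f g)" unfolding Q by (rule subst_op_add[OF Lm I])
  show "additive (Q f)" by (simp add: additive_def Q I' subst_op_add_fun[OF Lm])
  show "Q (pCons 0 f) g = - pCons 0 (Q f g)"
    by (simp add: Q subst_op_pCons[OF Lm] additive.zero[OF I]) (simp add: Lm_def)
  have "I (pCons 0 g) = (\<lambda>a. Rm (I g a))"
    by (simp add: I_def fun_eq_iff subst_op_pCons[OF Rm] additive.zero[OF Gr])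
  then have "Q f (pCons 0 g) = Rm (Q f g)"
    unfolding Q by (intro subst_op_commute_id) (auto simp: Rm Lm com additive.zero[OF I])
  then show "Q f (pCons 0 g) = map_poly (pCons 0) (Q f g) + pCons 0 (Q f g)" by (simp add: Rm_def)
  show "Q [:a:] [:b:] = quadratic_generator_bracket circ br a b"
    by (simp add: Q subst_op_pCons Lm additive.zero[OF I] additive.zero[OF Lm] subst_op_0)
      (simp add: I_def subst_op_pCons Rm additive.zero[OF Gr] additive.zero[OF Rm] subst_op_0, simp add: G_def)
qed

lemma commutator_product_rules:
  fixes hs :: "'k::field poly \<Rightarrow> 'a::ab_group_add \<Rightarrow> 'a"
  assumes "conformal_product hs UNIV pr"
  defines "D \<equiv> hs [:0, 1:]" and "c \<equiv> commutator_product hs pr"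
  shows "additive (\<lambda>a. c a b)" and "additive (c a)"
    and "c (D a) b = - pCons 0 (c a b)"
    and "c a (D b) = map_poly D (c a b) + pCons 0 (c a b)"
proof -
  interpret conformal_product hs UNIV pr by fact
  define N where "N = (\<lambda>q. - map_poly D q - pCons 0 q)"
  define c1 :: "'a \<Rightarrow> 'a poly" where "c1 = (\<lambda>v. [:v:])"
  define Op where "Op a b = subst_op N c1 (pr b a)" for a b
  have D: "additive D" by (simp add: additive_def D_def scale_right_distrib)
  have mD: "additive (map_poly D)" by (rule additive_map_poly[OF D])
  have N: "additive N" by (simp add: additive_def N_def additive.add[OF mD])
  have c1: "additive c1" by (simp add: additive_def c1_def)
  have c: "c a b = pr a b - Op a b" for a b
    by (simp add: c_def commutator_product_def opposite_def Op_def N_def D_def c1_def)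
  have pr: "pr (a + a') b = pr a b + pr a' b" "pr a (b + b') = pr a b + pr a b'"
    "pr (D a) b = - pCons 0 (pr a b)" "pr a (D b) = map_poly D (pr a b) + pCons 0 (pr a b)" for a a' b b'
    by (simp_all add: D_def add_left add_right sesqui_left sesqui_right)
  have N_eq: "N q = - map_poly D q - pCons 0 q" for q by (simp add: N_def)
  note s = subst_op_add[OF N c1]
  have sD: "subst_op N c1 (map_poly D q) = map_poly D (subst_op N c1 q)" for q
  proof (rule subst_op_commute[OF mD N])
    show "map_poly D (N u) = N (map_poly D u)" for u
      by (simp add: N_eq additive.diff[OF mD] additive.minus[OF mD] map_poly_pCons additive.zero[OF D])
  qed (simp_all add: c1_def map_poly_pCons additive.zero[OF D])
  have sl: "subst_op N c1 (pCons 0 q) = N (subst_op N c1 q)" for q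
    by (simp add: subst_op_pCons[OF N] additive.zero[OF c1])
  have Op: "Op (D a) b = - pCons 0 (Op a b)" "Op a (D b) = map_poly D (Op a b) + pCons 0 (Op a b)" for a b
    by (simp_all add: Op_def pr additive.add[OF s] additive.minus[OF s] sD sl N_eq del: minus_pCons)
  show "additive (\<lambda>a. c a b)" and "additive (c a)"
    by (simp_all add: additive_def c Op_def pr additive.add[OF s])
  show "c (D a) b = - pCons 0 (c a b)" by (simp add: c Op pr)
  show "c a (D b) = map_poly D (c a b) + pCons 0 (c a b)" by (simp add: c Op pr additive.diff[OF mD])
qed

text \<open>
  The bracket of \<open>L(V)\<close> and the commutator are both sesquilinear in \<open>\<partial>\<close>, so an \<open>H\<close>-linear map out of
  the free module \<open>L(V)\<close> is a homomorphism once it respects brackets of generators.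
\<close>

lemma quadratic_conformal_hom:
  fixes scale :: "'k::field \<Rightarrow> 'v::ab_group_add \<Rightarrow> 'v"
    and hs :: "'k poly \<Rightarrow> 'a::ab_group_add \<Rightarrow> 'a"
  assumes gd: "gelfand_dorfman_algebra scale circ br"
    and cp: "conformal_product hs UNIV pr"
    and t: "additive t" "\<And>k v. t (scale k v) = hs [:k:] (t v)"
  defines "\<tau> \<equiv> subst_op (hs [:0, 1:]) t"
  assumes gen: "\<And>a b. commutator_product hs pr (t a) (t b) =
      map_poly \<tau> (quadratic_generator_bracket circ br a b)"
  shows "conformal_hom (free_scale scale) UNIV (quadratic_bracket circ br)
           hs UNIV (commutator_product hs pr) \<tau>"
proof -
  interpret gelfand_dorfman_algebra scale circ br by fact
  interpret A: conformal_product hs UNIV pr by fact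
  have vs: "vector_space scale" by unfold_locales
  note fs = free_scale_simps[OF vs]
  define D where "D = hs [:0, 1:]"
  define c where "c = commutator_product hs pr"
  define Q where "Q = quadratic_bracket circ br"
  note c_rules = commutator_product_rules[OF cp, folded D_def c_def]
  note Q_rules = quadratic_bracket_rules[OF gd, folded Q_def]
  have D: "additive D" by (simp add: additive_def D_def A.scale_right_distrib)
  have mD: "additive (map_poly D)" by (rule additive_map_poly[OF D])
  have \<tau>: "additive \<tau>" unfolding \<tau>_def D_def[symmetric] by (rule subst_op_add[OF D t(1)])
  have m\<tau>: "additive (map_poly \<tau>)" by (rule additive_map_poly[OF \<tau>])
  have \<tau>_pCons: "\<tau> (pCons a f) = t a + D (\<tau> f)" for a f
    unfolding \<tau>_def D_def[symmetric] by (simp add: subst_op_pCons[OF D] additive.zero[OF t(1)])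
  have \<tau>_D: "\<tau> (pCons 0 f) = D (\<tau> f)" for f by (simp add: \<tau>_pCons additive.zero[OF t(1)])
  have \<tau>_const: "\<tau> [:a:] = t a" for a
    by (simp add: \<tau>_pCons additive.zero[OF \<tau>] additive.zero[OF D])
  have m\<tau>_D: "map_poly \<tau> (map_poly (pCons 0) P) = map_poly D (map_poly \<tau> P)"
    "map_poly \<tau> (pCons 0 P) = pCons 0 (map_poly \<tau> P)" for P
    by (intro poly_eqI, simp add: coeff_map_poly coeff_pCons \<tau>_D additive.zero[OF \<tau>] additive.zero[OF D] split: nat.splits)+
  note adds = additive.add[OF m\<tau>] additive.minus[OF m\<tau>] additive.diff[OF mD] additive.add[OF \<tau>]
     additive.zero[OF mD] additive.add[OF c_rules(1)] additive.add[OF c_rules(2)]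
     additive.add[OF Q_rules(1)] additive.add[OF Q_rules(2)] c_rules(3,4) Q_rules(3,4) m\<tau>_D \<tau>_D
  have J: "c (\<tau> f) (\<tau> g) - map_poly \<tau> (Q f g) = 0" for f g
  proof (rule poly_additive_zero[where J = "\<lambda>f. c (\<tau> f) (\<tau> g) - map_poly \<tau> (Q f g)" and T = "\<lambda>P. - pCons 0 P"])
    show "c (\<tau> [:a:]) (\<tau> g) - map_poly \<tau> (Q [:a:] g) = 0" for a
    proof (rule poly_additive_zero[where J = "\<lambda>g. c (\<tau> [:a:]) (\<tau> g) - map_poly \<tau> (Q [:a:] g)"
          and T = "\<lambda>P. map_poly D P + pCons 0 P"])
      show "c (\<tau> [:a:]) (\<tau> [:b:]) - map_poly \<tau> (Q [:a:] [:b:]) = 0" for b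
        using gen[of a b] by (simp add: Q_rules(5) \<tau>_const c_def)
    qed (simp_all add: additive_def adds)
  qed (simp_all add: additive_def adds)
  have hom_hs: "\<tau> (free_scale scale h f) = hs h (\<tau> f)" for h f
  proof (induction h)
    case 0
    then show ?case by (simp add: fs additive.zero[OF \<tau>])
  next
    case (pCons k p)
    have "pCons k p = [:k:] + [:0, 1:] * p" by simp
    then have "hs (pCons k p) x = hs [:k:] x + D (hs p x)" for x
      unfolding D_def by (metis A.scale_left_distrib A.scale_scale)
    moreover have "\<tau> (map_poly (scale k) f) = hs [:k:] (\<tau> f)"
    proof (induction f)
      case 0
      then show ?case by (simp add: additive.zero[OF \<tau>])
    next
      case (pCons a f)
      have "hs [:k:] (D x) = D (hs [:k:] x)" for x by (simp add: D_def)
      with pCons show ?case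
        by (simp add: map_poly_pCons \<tau>_pCons t(2) A.scale_right_distrib)
    qed
    ultimately show ?case using pCons by (simp add: fs additive.add[OF \<tau>] \<tau>_D)
  qed
  show ?thesis
    unfolding conformal_hom_def using J by (simp add: additive.add[OF \<tau>] hom_hs c_def Q_def)
qed

section \<open>Representations of differential Poisson algebras\<close>

text \<open>
  The relations are those between the operators \<open>m a = (a \<cdot> -)\<close>, \<open>h a = {a, -}\<close> and \<open>D = d\<close> on a
  differential Poisson algebra.  They determine \<open>D\<close> only up to elements which commute with all
  \<open>m a\<close> and \<open>h a\<close>, and this freedom is used below to obtain a faithful representation.
\<close>

locale differential_poisson_representation =
  P: differential_poisson_algebra scaleP pm pb d + assoc_algebra scale mul
  for scaleP :: "'k::field \<Rightarrow> 'p::ab_group_add \<Rightarrow> 'p"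
    and pm pb :: "'p \<Rightarrow> 'p \<Rightarrow> 'p"
    and d :: "'p \<Rightarrow> 'p"
    and scale :: "'k \<Rightarrow> 'e::ab_group_add \<Rightarrow> 'e"
    and mul :: "'e \<Rightarrow> 'e \<Rightarrow> 'e" (infixl "\<star>" 70) +
  fixes m h :: "'p \<Rightarrow> 'e" and D :: 'e
  assumes m_linear: "Vector_Spaces.linear scaleP scale m"
    and h_linear: "Vector_Spaces.linear scaleP scale h"
    and m_mul: "m (pm a b) = m a \<star> m b"
    and h_mul: "h (pm a b) = m a \<star> h b + m b \<star> h a"
    and m_br: "m (pb a b) = h a \<star> m b - m b \<star> h a"
    and h_br: "h (pb a b) = h a \<star> h b - h b \<star> h a"
    and m_d: "m (d a) = D \<star> m a - m a \<star> D"
    and h_d: "h (d a) = D \<star> h a - h a \<star> D"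
begin

text \<open>
  The polynomial \<open>h a + x m(d a) - \<partial> D m a\<close>, that is, the family of Hamiltonian operators
  \<open>f h a - f m(d a) \<partial>\<^sub>t + f' m a D\<close>, rewritten with \<open>\<partial>\<^sub>t = -x\<close> to the left of \<open>f\<close> and with \<open>f' = -\<partial>\<close>.
  Moving \<open>\<partial>\<^sub>t\<close> to the left of \<open>f\<close> produces the term \<open>f' m(d a)\<close>, which turns \<open>m a D\<close> into \<open>D m a\<close>.
\<close>

definition current :: "'p \<Rightarrow> 'e poly poly" where
  "current a = [: [:h a, m (d a):], [: - (D \<star> m a) :] :]"

lemma additive_d: "additive d"
  by (rule linear_additive[OF P.derivation_linear])

lemma additive_current: "additive current"
  using additive.add[OF linear_additive[OF m_linear]] additive.add[OF linear_additive[OF h_linear]]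
    additive.add[OF additive_d] additive.add[OF additive_mul(2)]
  by (simp add: additive_def current_def)

lemma current_scale: "current (scaleP k a) = hs [:k:] (current a)"
  using linear_scale[OF m_linear] linear_scale[OF h_linear] linear_scale[OF P.derivation_linear]
  by (simp add: current_def hs_simps map_poly_pCons mul_scale scale_minus_right)

text \<open>The product has degree at most 2 in \<open>\<lambda>\<close>, whence the locality bound 3.\<close>

lemma current_product:
  "Q (current a) (current b) =
    [:[:[:h a \<star> h b, m (d a) \<star> h b + h a \<star> m (d b), m (d a) \<star> m (d b):],
       [:- (h a \<star> (D \<star> m b)), - (m (d a) \<star> (D \<star> m b)):]:],
     [:[:h a \<star> m (d b) + (D \<star> m a) \<star> h b - h a \<star> (D \<star> m b),
        m (d a) \<star> m (d b) + (D \<star> m a) \<star> m (d b) - m (d a) \<star> (D \<star> m b):],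
       [:- ((D \<star> m a) \<star> (D \<star> m b)):]:],
     [:[:(D \<star> m a) \<star> m (d b) - (D \<star> m a) \<star> (D \<star> m b):]:]:]"
proof -
  have split: "[: [:p, q:], [:r:] :] = [:[:p:]:] + map_poly (pCons 0) [:[:q:]:] + pCons 0 [:[:r:]:]" for p q r :: 'e
    by (simp add: map_poly_pCons)
  show ?thesis
    unfolding current_def split
    by (simp add: additive.add[OF cend_product_rules(1)] additive.add[OF cend_product_rules(2)]
        cend_product_rules additive.minus[OF additive_mul(1)] additive.minus[OF additive_mul(2)] del: map_poly_pCons)
      (simp add: map_poly_pCons)
qed

text \<open>
  The right-hand side is \<open>\<tau>([a \<^sub>\<lambda> b])\<close> for the bracket of \<open>L(P)\<close> with \<open>a \<circ> b = a d(b)\<close>, where \<open>\<tau>\<close> is the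
  \<open>H\<close>-linear extension of \<open>current\<close>.
\<close>

lemma commutator_current:
  "commutator_product hs Q (current a) (current b) =
     [: current (pb a b) + pCons 0 (current (pm b (d a))), current (pm a (d b) + pm b (d a)) :]"
proof -
  have mD: "additive (map_poly (pCons 0) :: 'e poly poly poly \<Rightarrow> _)"
    by (intro additive_map_poly additive_pCons)
  have N: "additive (\<lambda>q :: 'e poly poly poly. - map_poly (pCons 0) q - pCons 0 q)"
    by (simp add: additive_def additive.add[OF mD])
  note mul_adds = additive.add[OF additive_mul(1)] additive.add[OF additive_mul(2)]
    additive.minus[OF additive_mul(1)] additive.minus[OF additive_mul(2)]
    additive.diff[OF additive_mul(1)] additive.diff[OF additive_mul(2)]
  note map_adds = additive.add[OF linear_additive[OF m_linear]] additive.add[OF linear_additive[OF h_linear]]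
    additive.minus[OF linear_additive[OF m_linear]] additive.minus[OF linear_additive[OF h_linear]]
    additive.add[OF additive_d]
  (* Normal forms in E: D is moved to the left and h to the right, and adjacent factors m x, m y
     are merged into m (pm x y).  The primed rules act on two factors, the doubly primed ones
     on the first two factors of a longer word. *)
  have mD': "m x \<star> D = D \<star> m x - m (d x)" for x by (simp add: m_d)
  have hD': "h x \<star> D = D \<star> h x - h (d x)" for x by (simp add: h_d)
  have hm': "h x \<star> m y = m y \<star> h x + m (pb x y)" for x y by (simp add: m_br)
  have mm': "m x \<star> m y = m (pm x y)" for x y by (simp add: m_mul)
  have mD'': "m x \<star> (D \<star> z) = D \<star> (m x \<star> z) - m (d x) \<star> z"
    and hD'': "h x \<star> (D \<star> z) = D \<star> (h x \<star> z) - h (d x) \<star> z"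
    and hm'': "h x \<star> (m y \<star> z) = m y \<star> (h x \<star> z) + m (pb x y) \<star> z"
    and mm'': "m x \<star> (m y \<star> z) = m (pm x y) \<star> z" for x y z
    by (simp_all add: mul_assoc[symmetric] mD' hD' hm' mm' mul_adds)
  have anti: "pb y x = - pb x y" for x y
    by (rule P.anticommute)
  (* Unrestricted, commutativity and anticommutativity would loop; b is put after a. *)
  note pm_comm = P.mul_commute[of b a] P.mul_commute[of "d b" a] P.mul_commute[of b "d a"] P.mul_commute[of "d b" "d a"]
     P.mul_commute[of "d (d b)" a] P.mul_commute[of b "d (d a)"]
  note anti' = anti[of b a] anti[of "d b" a] anti[of b "d a"] anti[of "d b" "d a"]
  show ?thesis
    unfolding commutator_product_def opposite_def current_product hs_simps
    by (simp add: subst_op_pCons[OF N] subst_op_0 map_poly_pCons)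
      (simp add: current_def, simp add: mul_assoc mul_adds map_adds mD' mD'' hD' hD'' hm' hm'' mm' mm''
        h_mul P.derivation_mul P.derivation_br pm_comm anti' h_br algebra_simps)
qed

lemma current_locality: "locality Q (current a) (current b) \<le> 3"
  by (simp add: locality_def current_product)

text \<open>
  The leading coefficient \<open>v\<close> of \<open>p\<close> can be tested separately: for \<open>a = f v\<close> and \<open>n = degree p\<close>, the
  image of \<open>p\<close> has \<open>m(d a)\<close> at \<open>\<partial>\<^sup>n x\<close> and \<open>- D m a\<close> at \<open>\<partial>\<^sup>n\<^sup>+\<^sup>1\<close>.
\<close>

lemma current_map_inj:
  assumes faithful: "\<And>a. m (d a) = 0 \<Longrightarrow> D \<star> m a = 0 \<Longrightarrow> a = 0"
    and f: "additive f" "inj f"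
  shows "inj (subst_op (pCons 0) (\<lambda>v. current (f v)))"
proof -
  define \<tau> where "\<tau> = subst_op (pCons 0) (\<lambda>v. current (f v))"
  have cf: "additive (\<lambda>v. current (f v))"
    by (simp add: additive_def additive.add[OF f(1)] additive.add[OF additive_current])
  have \<tau>: "additive \<tau>" unfolding \<tau>_def by (rule subst_op_add[OF additive_pCons cf])
  have \<tau>_pCons: "\<tau> (pCons v p) = current (f v) + pCons 0 (\<tau> p)" for v p
    unfolding \<tau>_def by (simp add: subst_op_pCons[OF additive_pCons] additive.zero[OF cf])
  have f0: "f v = 0 \<Longrightarrow> v = 0" for v
    using f(2) additive.zero[OF f(1)] by (metis injD)
  have x_coeff: "coeff (coeff (\<tau> p) n) 1 = m (d (f (coeff p n)))" for p n
  proof (induction p arbitrary: n)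
    case 0
    then show ?case
      by (simp add: additive.zero[OF \<tau>] additive.zero[OF f(1)] additive.zero[OF additive_d]
        additive.zero[OF linear_additive[OF m_linear]])
  next
    case (pCons v p)
    then show ?case by (auto simp: \<tau>_pCons current_def coeff_pCons split: nat.splits)
  qed
  have const_coeff: "coeff (coeff (\<tau> p) (Suc n)) 0 = h (f (coeff p (Suc n))) - D \<star> m (f (coeff p n))" for p n
  proof (induction p arbitrary: n)
    case 0
    then show ?case
      by (simp add: additive.zero[OF \<tau>] additive.zero[OF f(1)] additive.zero[OF additive_mul(2)]
        additive.zero[OF linear_additive[OF m_linear]] additive.zero[OF linear_additive[OF h_linear]])
  next
    case (pCons v p)
    have "coeff (coeff (\<tau> p) 0) 0 = h (f (coeff p 0))"
      by (cases p) (simp add: \<tau>_pCons current_def additive.zero[OF \<tau>] additive.zero[OF f(1)]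
        additive.zero[OF linear_additive[OF h_linear]])
    with pCons show ?case by (auto simp: \<tau>_pCons current_def coeff_pCons split: nat.splits)
  qed
  have zero: "p = 0" if "\<tau> p = 0" for p
  proof -
    let ?a = "f (coeff p (degree p))"
    have "m (d ?a) = 0" using x_coeff[of p "degree p"] that by simp
    moreover have "D \<star> m ?a = 0"
      using const_coeff[of p "degree p"] that
      by (simp add: coeff_eq_0 additive.zero[OF f(1)] additive.zero[OF linear_additive[OF h_linear]])
    ultimately have "lead_coeff p = 0" by (intro f0 faithful)
    then show ?thesis by simp
  qed
  show ?thesis
    unfolding \<tau>_def[symmetric]
  proof (rule injI)
    fix p q assume "\<tau> p = \<tau> q"
    then show "p = q" using zero[of "p - q"] by (simp add: additive.diff[OF \<tau>])
  qed
qed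

end

section \<open>The adjoint representation\<close>

text \<open>
  For a function \<open>f\<close> that is not additive, \<open>f \<circ> (g + g')\<close> differs from \<open>f \<circ> g + f \<circ> g'\<close>, so only the
  linear maps form an algebra.  Composing with a linear projection of the space of all functions onto the
  linear ones gives a bilinear associative product on the whole function type which extends
  composition of linear maps, and so spares the bookkeeping of a carrier set.
\<close>

lemma exists_total_composition:
  fixes scale :: "'k::field \<Rightarrow> 'm::ab_group_add \<Rightarrow> 'm"
  assumes "vector_space scale"
  obtains mul :: "('m \<Rightarrow> 'm) \<Rightarrow> ('m \<Rightarrow> 'm) \<Rightarrow> ('m \<Rightarrow> 'm)" where
    "assoc_algebra (\<lambda>k f x. scale k (f x)) mul"
    "\<And>f g. Vector_Spaces.linear scale scale f \<Longrightarrow> Vector_Spaces.linear scale scale g \<Longrightarrow> mul f g = f \<circ> g"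
proof -
  interpret V: vector_space scale by fact
  let ?s = "\<lambda>k (f :: 'm \<Rightarrow> 'm) x. scale k (f x)"
  let ?lin = "Vector_Spaces.linear scale scale"
  interpret E: vector_space ?s
    by standard (auto simp: fun_eq_iff V.scale_right_distrib V.scale_left_distrib)
  interpret EE: vector_space_pair ?s ?s by unfold_locales
  interpret VV: vector_space_pair scale scale ..
  have sub: "E.subspace {f. ?lin f}"
    by (rule E.subspaceI) (auto simp: VV.linear_zero VV.linear_compose_add VV.linear_compose_scale_right
      zero_fun_def plus_fun_def)
  obtain \<pi> where \<pi>: "range \<pi> \<subseteq> {f. ?lin f}" "Vector_Spaces.linear ?s ?s \<pi>" "\<And>f. ?lin f \<Longrightarrow> \<pi> f = f"
    using EE.linear_exists_left_inverse_on[OF E.linear_id sub] by (auto simp: id_def)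
  have lin: "?lin (\<pi> f)" for f using \<pi>(1) by auto
  have comp: "?lin (f \<circ> g)" if "?lin f" "?lin g" for f g
    using that by (rule Vector_Spaces.linear_compose[rotated])
  note \<pi>_add = additive.add[OF linear_additive[OF \<pi>(2)]] and \<pi>_scale = linear_scale[OF \<pi>(2)]
  define mul where "mul f g = \<pi> f \<circ> \<pi> g" for f g
  have "assoc_algebra ?s mul"
  proof (intro assoc_algebra.intro bilinear_algebra.intro bilinear_algebra_axioms.intro assoc_algebra_axioms.intro E.vector_space_axioms)
    show "Vector_Spaces.linear ?s ?s (\<lambda>f. mul f g)" for g
      by (rule linearI[OF E.vector_space_axioms E.vector_space_axioms]) (simp_all add: mul_def \<pi>_add \<pi>_scale fun_eq_iff)
    show "Vector_Spaces.linear ?s ?s (mul f)" for f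
      by (rule linearI[OF E.vector_space_axioms E.vector_space_axioms])
        (simp_all add: mul_def \<pi>_add \<pi>_scale fun_eq_iff additive.add[OF linear_additive[OF lin]] linear_scale[OF lin])
    show "mul (mul f g) k = mul f (mul g k)" for f g k
      by (simp add: mul_def \<pi>(3) comp lin o_assoc)
  qed
  moreover have "mul f g = f \<circ> g" if "?lin f" "?lin g" for f g
    using that by (simp add: mul_def \<pi>(3))
  ultimately show thesis by (rule that)
qed

context differential_poisson_algebra
begin

text \<open>
  The pair \<open>(k, p)\<close> stands for \<open>k 1 + p\<close> in the unital hull of the algebra, with \<open>d 1 = 0\<close> and
  \<open>{a, 1} = 0\<close>.
\<close>

definition hull_scale :: "'k \<Rightarrow> 'k \<times> 'p \<Rightarrow> 'k \<times> 'p" where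
  "hull_scale c x = (c * fst x, scale c (snd x))"

definition hull_mult :: "'p \<Rightarrow> 'k \<times> 'p \<Rightarrow> 'k \<times> 'p" where
  "hull_mult a x = (0, scale (fst x) a + a \<cdot> snd x)"

definition hull_ad :: "'p \<Rightarrow> 'k \<times> 'p \<Rightarrow> 'k \<times> 'p" where
  "hull_ad a x = (0, br a (snd x))"

text \<open>
  This is \<open>d + 1\<close>.  With \<open>d\<close> alone, an element \<open>a\<close> with \<open>d a = 0\<close> would satisfy \<open>D m a = m a D\<close>, which
  vanishes on the unit, and if moreover \<open>a d(p) = 0\<close> for all \<open>p\<close> and \<open>a\<close> is central, \<open>current a\<close> would
  vanish.
\<close>

definition hull_shifted_derivation :: "'k \<times> 'p \<Rightarrow> 'k \<times> 'p" where
  "hull_shifted_derivation x = (fst x, d (snd x) + snd x)"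

lemma additive_ops: "additive (\<lambda>x. x \<cdot> y)" "additive (\<lambda>y. x \<cdot> y)" "additive (\<lambda>x. br x y)" "additive (br x)" "additive d"
proof -
  have b: "bilinear_algebra scale mul" "bilinear_algebra scale br" by unfold_locales
  show "additive (\<lambda>x. x \<cdot> y)" "additive (\<lambda>y. x \<cdot> y)" "additive (\<lambda>x. br x y)" "additive (br x)"
    using b[THEN bilinear_algebra.additive_mul(1)] b[THEN bilinear_algebra.additive_mul(2)] by auto
  show "additive d" by (rule linear_additive[OF derivation_linear])
qed

lemma scale_ops: "scale k x \<cdot> y = scale k (x \<cdot> y)" "x \<cdot> scale k y = scale k (x \<cdot> y)"
  "br (scale k x) y = scale k (br x y)" "br x (scale k y) = scale k (br x y)" "d (scale k x) = scale k (d x)"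
proof -
  have b: "bilinear_algebra scale mul" "bilinear_algebra scale br" by unfold_locales
  show "scale k x \<cdot> y = scale k (x \<cdot> y)" "x \<cdot> scale k y = scale k (x \<cdot> y)"
    "br (scale k x) y = scale k (br x y)" "br x (scale k y) = scale k (br x y)"
    by (rule b[THEN bilinear_algebra.mul_scale(1)] b[THEN bilinear_algebra.mul_scale(2)])+
  show "d (scale k x) = scale k (d x)" by (rule linear_scale[OF derivation_linear])
qed

lemma jacobi': "br a (br b c) = br b (br a c) + br (br a b) c"
proof -
  have "br b (br c a) = - br b (br a c)"
    by (simp add: anticommute[of c a] additive.minus[OF additive_ops(4)])
  with jacobi[of a b c] anticommute[of c "br a b"] show ?thesis by (simp add: algebra_simps)
qed

lemma leibniz_left: "br (a \<cdot> b) c = a \<cdot> br b c + b \<cdot> br a c"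
  by (simp add: anticommute[of _ c] leibniz additive.minus[OF additive_ops(2)] mul_commute)

lemma exists_faithful_representation:
  obtains mul' and m h :: "'p \<Rightarrow> 'k \<times> 'p \<Rightarrow> 'k \<times> 'p" and D where
    "differential_poisson_representation scale mul br d (\<lambda>k f x. hull_scale k (f x)) mul' m h D"
    "\<And>a. m (d a) = 0 \<Longrightarrow> mul' D (m a) = 0 \<Longrightarrow> a = 0"
proof -
  let ?lin = "Vector_Spaces.linear hull_scale hull_scale"
  interpret H: vector_space hull_scale
    by standard (auto simp: hull_scale_def algebra_simps)
  interpret HH: vector_space_pair hull_scale hull_scale ..
  obtain mul' where mul': "assoc_algebra (\<lambda>k f x. hull_scale k (f x)) mul'"
    "\<And>f g. ?lin f \<Longrightarrow> ?lin g \<Longrightarrow> mul' f g = f \<circ> g"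
    using exists_total_composition[OF H.vector_space_axioms] by blast
  have E_vs: "vector_space (\<lambda>k (f :: 'k \<times> 'p \<Rightarrow> 'k \<times> 'p) x. hull_scale k (f x))"
    using mul'(1) by (simp add: assoc_algebra_def bilinear_algebra_def)
  note ops = additive_ops[THEN additive.add] scale_ops scale_right_distrib scale_left_distrib
  have lin: "?lin (hull_mult a)" "?lin (hull_ad a)" "?lin hull_shifted_derivation" for a
    by (rule linearI[OF H.vector_space_axioms H.vector_space_axioms], auto simp: hull_mult_def hull_ad_def hull_shifted_derivation_def hull_scale_def ops ac_simps)+
  note mul_eq = mul'(2)[OF lin(1) lin(1)] mul'(2)[OF lin(1) lin(2)] mul'(2)[OF lin(2) lin(1)]
    mul'(2)[OF lin(2) lin(2)] mul'(2)[OF lin(3) lin(1)] mul'(2)[OF lin(1) lin(3)]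
    mul'(2)[OF lin(3) lin(2)] mul'(2)[OF lin(2) lin(3)]
  note defs = hull_mult_def hull_ad_def hull_shifted_derivation_def hull_scale_def
  have rep: "differential_poisson_representation scale mul br d (\<lambda>k f x. hull_scale k (f x)) mul'
    hull_mult hull_ad hull_shifted_derivation"
  proof (intro differential_poisson_representation.intro differential_poisson_representation_axioms.intro
      differential_poisson_algebra_axioms mul'(1))
    show "Vector_Spaces.linear scale (\<lambda>k f x. hull_scale k (f x)) hull_mult"
      by (rule linearI[OF vector_space_axioms E_vs]) (auto simp: defs fun_eq_iff ops ac_simps)
    show "Vector_Spaces.linear scale (\<lambda>k f x. hull_scale k (f x)) hull_ad"
      by (rule linearI[OF vector_space_axioms E_vs]) (auto simp: defs fun_eq_iff ops ac_simps)
    fix a b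
    show "hull_mult (a \<cdot> b) = mul' (hull_mult a) (hull_mult b)"
      unfolding mul_eq by (simp add: fun_eq_iff defs ops mul_assoc)
    show "hull_ad (a \<cdot> b) = mul' (hull_mult a) (hull_ad b) + mul' (hull_mult b) (hull_ad a)"
      unfolding mul_eq by (auto simp: fun_eq_iff defs ops leibniz_left)
    show "hull_mult (br a b) = mul' (hull_ad a) (hull_mult b) - mul' (hull_mult b) (hull_ad a)"
      unfolding mul_eq by (auto simp: fun_eq_iff defs ops leibniz)
    show "hull_ad (br a b) = mul' (hull_ad a) (hull_ad b) - mul' (hull_ad b) (hull_ad a)"
      unfolding mul_eq by (auto simp: fun_eq_iff defs ops jacobi'[of a b])
    show "hull_mult (d a) = mul' hull_shifted_derivation (hull_mult a) - mul' (hull_mult a) hull_shifted_derivation"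
      unfolding mul_eq by (auto simp: fun_eq_iff defs ops derivation_mul)
    show "hull_ad (d a) = mul' hull_shifted_derivation (hull_ad a) - mul' (hull_ad a) hull_shifted_derivation"
      unfolding mul_eq by (auto simp: fun_eq_iff defs ops derivation_br)
  qed
  have "a = 0" if "hull_mult (d a) = 0" "mul' hull_shifted_derivation (hull_mult a) = 0" for a
  proof -
    (* The unit of the hull is (1, 0). *)
    have "d a = 0"
      using fun_cong[OF that(1), of "(1, 0)"] by (simp add: hull_mult_def zero_prod_def additive_ops[THEN additive.zero])
    then show ?thesis
      using fun_cong[OF that(2), of "(1, 0)"]
      by (simp add: mul_eq defs zero_prod_def additive_ops[THEN additive.zero])
  qed
  with rep show thesis by (rule that)
qed

end

section \<open>Generated envelopes and the embedding\<close>

lemma assoc_conformal_subalgebra: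
  assumes "assoc_conformal_algebra hs A pr" "conformal_subalgebra hs pr S" "S \<subseteq> A"
  shows "assoc_conformal_algebra hs S pr"
proof -
  interpret assoc_conformal_algebra hs A pr by fact
  note S = conformal_subalgebraD[OF assms(2)]
  have A: "x \<in> S \<Longrightarrow> x \<in> A" for x using assms(3) by auto
  show ?thesis
    by unfold_locales
      (use S in \<open>auto simp: A add_left add_right scale_left scale_right sesqui_left sesqui_right conformal_assoc\<close>)
qed

text \<open>
  The image of \<open>\<tau>\<close> need not generate \<open>A\<close>, so \<open>A\<close> is cut down to the intersection of all subalgebras
  that contain this image.
\<close>

lemma conformal_hom_envelope:
  assumes L: "lie_conformal_algebra hsC C lb" and A: "assoc_conformal_algebra hs A pr"
    and hom: "conformal_hom hsC C lb hs A (commutator_product hs pr) \<tau>"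
  obtains S where "assoc_envelope hsC C lb hs S pr \<tau>"
proof -
  interpret A: assoc_conformal_algebra hs A pr by fact
  define S where "S = \<Inter>{S. S \<subseteq> A \<and> conformal_subalgebra hs pr S \<and> \<tau> ` C \<subseteq> S}"
  have AA: "A \<subseteq> A \<and> conformal_subalgebra hs pr A \<and> \<tau> ` C \<subseteq> A"
    using hom A.subspace_C A.closed by (auto simp: conformal_subalgebra_def conformal_hom_def)
  have SA: "S \<subseteq> A" unfolding S_def using AA by blast
  have S: "conformal_subalgebra hs pr S"
    unfolding conformal_subalgebra_def
  proof (intro conjI ballI allI)
    show "A.subspace S"
      unfolding S_def by (rule A.subspace_Inter) (auto simp: conformal_subalgebra_def)
  qed (auto simp: S_def conformal_subalgebra_def)
  have "\<tau> ` C \<subseteq> S" by (auto simp: S_def)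
  then have "conformal_hom hsC C lb hs S (commutator_product hs pr) \<tau>"
    using hom by (simp add: conformal_hom_def)
  moreover have "T = S" if "T \<subseteq> S" "conformal_subalgebra hs pr T" "\<tau> ` C \<subseteq> T" for T
    using that SA by (auto simp: S_def)
  ultimately have "assoc_envelope hsC C lb hs S pr \<tau>"
    unfolding assoc_envelope_def using L assoc_conformal_subalgebra[OF A S SA] by auto
  then show thesis by (rule that)
qed

theorem theorem4p2:
  fixes scale :: "'k::field_char_0 \<Rightarrow> 'v::ab_group_add \<Rightarrow> 'v"
    and circ br :: "'v \<Rightarrow> 'v \<Rightarrow> 'v"
    and hsU :: "'k poly \<Rightarrow> 'u::ab_group_add \<Rightarrow> 'u"
    and U :: "'u set"
    and prU :: "'u \<Rightarrow> 'u \<Rightarrow> 'u poly"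
    and \<tau>U :: "'v poly \<Rightarrow> 'u"
  assumes "special_gd_algebra TYPE('p::ab_group_add) scale circ br"
    and "universal_assoc_envelope (free_scale scale) UNIV (quadratic_bracket circ br)
           (range (\<lambda>v. [:v:])) (\<lambda>_ _. 3) hsU U prU \<tau>U"
  shows "inj \<tau>U"
proof -
  obtain scaleP :: "'k \<Rightarrow> 'p \<Rightarrow> 'p" and mulP brP d f where
    P: "differential_poisson_algebra scaleP mulP brP d"
    and f: "gd_hom scale circ br scaleP (\<lambda>a b. mulP a (d b)) brP f" "inj f"
    and gd: "gelfand_dorfman_algebra scale circ br"
    using assms(1) unfolding special_gd_algebra_def by blast
  interpret P: differential_poisson_algebra scaleP mulP brP d by (rule P)
  obtain mul' and m h :: "'p \<Rightarrow> 'k \<times> 'p \<Rightarrow> 'k \<times> 'p" and D where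
    rep: "differential_poisson_representation scaleP mulP brP d (\<lambda>k f x. P.hull_scale k (f x)) mul' m h D"
    and faithful: "\<And>a. m (d a) = 0 \<Longrightarrow> mul' D (m a) = 0 \<Longrightarrow> a = 0"
    by (rule P.exists_faithful_representation) blast
  interpret R: differential_poisson_representation scaleP mulP brP d "\<lambda>k f x. P.hull_scale k (f x)" mul' m h D
    by (rule rep)
  have f_lin: "Vector_Spaces.linear scale scaleP f"
    and f_circ: "f (circ a b) = mulP (f a) (d (f b))" and f_br: "f (br a b) = brP (f a) (f b)" for a b
    using f(1) by (auto simp: gd_hom_def)
  note f_add = linear_additive[OF f_lin]
  define t where "t v = R.current (f v)" for v
  define \<tau> where "\<tau> = subst_op (R.hs [:0, 1:]) t"
  have t_add: "additive t"
    by (simp add: additive_def t_def additive.add[OF f_add] additive.add[OF R.additive_current])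
  have t_scale: "t (scale k v) = R.hs [:k:] (t v)" for k v
    by (simp add: t_def linear_scale[OF f_lin] R.current_scale)
  have \<tau>_pCons: "\<tau> (pCons v p) = t v + pCons 0 (\<tau> p)" for v p
    by (simp add: \<tau>_def R.hs_simps subst_op_pCons additive_pCons additive.zero[OF t_add])
  have \<tau>_0: "\<tau> 0 = 0" by (simp add: \<tau>_def subst_op_0 additive.zero[OF t_add])
  have gen: "commutator_product R.hs R.Q (t a) (t b) =
      map_poly \<tau> (quadratic_generator_bracket circ br a b)" for a b
    by (simp add: t_def R.commutator_current quadratic_generator_bracket_def map_poly_pCons \<tau>_pCons \<tau>_0
        f_circ f_br additive.add[OF f_add])
  have hom: "conformal_hom (free_scale scale) UNIV (quadratic_bracket circ br) R.hs UNIV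
      (commutator_product R.hs R.Q) \<tau>"
    unfolding \<tau>_def
    by (rule quadratic_conformal_hom[OF gd R.conformal_product_cend t_add t_scale gen[unfolded \<tau>_def]])
  obtain S where env: "assoc_envelope (free_scale scale) UNIV (quadratic_bracket circ br) R.hs S R.Q \<tau>"
    using conformal_hom_envelope[OF quadratic_lie_conformal(1)[OF gd] R.assoc_conformal_algebra_cend hom] .
  have "\<exists>\<phi>. conformal_hom hsU U prU R.hs S R.Q \<phi> \<and> (\<forall>c\<in>UNIV. \<tau> c = \<phi> (\<tau>U c))"
    by (rule universal_envelope_property[OF assms(2) env])
      (auto simp: \<tau>_pCons \<tau>_0 t_def R.current_locality)
  then obtain \<phi> where "\<tau> = \<phi> \<circ> \<tau>U" by (auto simp: fun_eq_iff)
  moreover have "inj \<tau>"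
    using R.current_map_inj[OF faithful f_add f(2)] by (simp add: \<tau>_def t_def[abs_def] R.hs_simps)
  ultimately show ?thesis by (metis inj_on_imageI2)
qed

end
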